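(* Let $M$ be a smooth manifold of dimension $n$, let $1\le p,q\le n$, let $x\in M$, and let $(x^1,\dots,x^n)$ be a coordinate system on a neighbourhood of $x$. Let $$\omega_p=\sum_{I\in\mathcal{I}_p^n}F_I\,dx^I,\qquad V_q=\sum_{I\in\mathcal{I}_q^n}\bar F_I\,\partial x^I$$ be a differential $p$-form and a $q$-vector field. For a system of functions $(u^1,\dots,u^n)$ with $du^1\wedge\cdots\wedge du^n\ne0$ put $\Gamma_{ij}^b=\sum_h v_h^b\,\frac{\partial^2u^h}{\partial x^i\partial x^j}$, where $(v^i_j)$ is the inverse of the Jacobian matrix $\left(\frac{\partial u^i}{\partial x^j}\right)$, and define functions $\Phi_{j,J}$ ($J\in\mathcal{I}_p^n$) and $\bar\Phi_{j,J}$ ($J\in\mathcal{I}_q^n$), $1\le j\le n$, by $$\sum_{J\in\mathcal{I}_p^n}\Phi_{j,J}\,dx^J=\sum_{I\in\mathcal{I}_p^n}\sum_{h=1}^p\sum_{i=1}^n\Gamma_{ji}^{i_h}F_I\,dx^{i_1}\wedge\cdots\wedge\underline{dx^i}\wedge\cdots\wedge dx^{i_p},$$ $$\sum_{J\in\mathcal{I}_q^n}\bar\Phi_{j,J}\,\partial x^J=\sum_{I\in\mathcal{I}_q^n}\sum_{h=1}^q\sum_{i=1}^n\Gamma_{j i_h}^{i}\bar F_I\,\tfrac{\partial}{\partial x^{i_1}}\wedge\cdots\wedge\underline{\tfrac{\partial}{\partial x^i}}\wedge\cdots\wedge \tfrac{\partial}{\partial x^{i_q}},$$ where $I=(i_1,i_2,\dots)$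 and the underlined factor replaces the $h$-th factor ($dx^{i_h}$, resp. $\frac{\partial}{\partial x^{i_h}}$) of the exterior product. Then $\omega_p$ has constant coefficients on a neighbourhood of $x$ if and only if the second-order partial differential system $$\text{(i)}\quad \frac{\partial F_J}{\partial x^j}=\Phi_{j,J},\qquad \forall J\in\mathcal{I}_p^n,\ 1\le j\le n,$$ for the unknowns $(u^1,\dots,u^n)$ admits a local solution $(u^1,\dots,u^n)$ defined on a neighbourhood of $x$ and with $2$-jets in $O_M^2$. Likewise, $V_q$ has constant coefficients on a neighbourhood of $x$ if and only if the second-order partial differential system $$\text{(ii)}\quad \frac{\partial\bar F_J}{\partial x^j}=-\bar\Phi_{j,J},\qquad\forall J\in\mathcal{I}_q^n,\ 1\le j\le n,$$ admits a local solution $(u^1,\dots,u^n)$ defined on a neighbourhood of $x$ and with $2$-jets in $O_M^2$.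
   Context: $\mathcal{I}_p^n$ is the set of multi-indices $I=(i_1,\dots,i_p)$ with $1\le i_1<\dots<i_p\le n$; $dx^I=dx^{i_1}\wedge\cdots\wedge dx^{i_p}$ and $\partial x^I=\frac{\partial}{\partial x^{i_1}}\wedge\cdots\wedge\frac{\partial}{\partial x^{i_q}}$ for $I\in\mathcal I_q^n$. $O_M^2\subset J^2(M,\mathbb{R}^n)$ is the open subbundle of $2$-jets $j_x^2(u^1,\dots,u^n)$ with $(du^1\wedge\cdots\wedge du^n)_x\ne0$. A $p$-form $\omega_p$ (resp. $q$-vector field $V_q$) has constant coefficients on a neighbourhood of $x\in M$ if there is a coordinate system $(u^1,\dots,u^n)$ centred at $x$ such that all the functions $\omega_p\left(\frac{\partial}{\partial u^{i_1}},\dots,\frac{\partial}{\partial u^{i_p}}\right)$ (resp. $V_q(du^{i_1},\dots,du^{i_q})$), for strictly increasing multi-indices, are constant on the coordinate domain. *)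

theory Defs
  imports "HOL-Analysis.Analysis"
begin

definition partial :: "'n::finite \<Rightarrow> (real^'n \<Rightarrow> real) \<Rightarrow> real^'n \<Rightarrow> real" where
  "partial i f y = deriv (\<lambda>t. f (y + t *\<^sub>R axis i 1)) 0"

primrec Ck_on :: "nat \<Rightarrow> (real^'n::finite) set \<Rightarrow> (real^'n \<Rightarrow> real) \<Rightarrow> bool" where
  "Ck_on 0 S f \<longleftrightarrow> continuous_on S f"
| "Ck_on (Suc k) S f \<longleftrightarrow> f differentiable_on S \<and> (\<forall>i. Ck_on k S (partial i f))"

definition smooth_on :: "(real^'n::finite) set \<Rightarrow> (real^'n \<Rightarrow> real) \<Rightarrow> bool" where
  "smooth_on S f \<longleftrightarrow> (\<forall>k. Ck_on k S f)"

text \<open>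
  A chart is a pair of an open set and a map into \<open>real^'n\<close>; only the values of the map on the open
  set matter. The index type \<open>'n\<close>, a finite linear order, plays the role of \<open>{1..n}\<close>, so that
  the dimension is \<open>CARD('n)\<close>. The manifold itself is the union of the chart domains; the
  Hausdorff property and second countability come from the sort of \<open>'a\<close>.
\<close>

type_synonym ('a, 'n) chart = "'a set \<times> ('a \<Rightarrow> real^'n)"

abbreviation chart_inv :: "('a, 'n) chart \<Rightarrow> real^'n \<Rightarrow> 'a" where
  "chart_inv c \<equiv> inv_into (fst c) (snd c)"

definition is_chart :: "('a::topological_space, 'n::finite) chart \<Rightarrow> bool" where
  "is_chart c \<longleftrightarrow> open (fst c) \<and> open (snd c ` fst c) \<and>
     homeomorphism (fst c) (snd c ` fst c) (snd c) (chart_inv c)"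

definition smooth_transition :: "('a, 'n::finite) chart \<Rightarrow> ('a, 'n) chart \<Rightarrow> bool" where
  "smooth_transition c d \<longleftrightarrow>
     (\<forall>i. smooth_on (snd c ` (fst c \<inter> fst d)) (\<lambda>y. snd d (chart_inv c y) $ i))"

definition smooth_manifold ::
    "('a::{t2_space,second_countable_topology}, 'n::finite) chart set \<Rightarrow> bool" where
  "smooth_manifold A \<longleftrightarrow>
     (\<forall>c\<in>A. is_chart c) \<and> (\<forall>c\<in>A. \<forall>d\<in>A. smooth_transition c d)"

definition points :: "('a, 'n) chart set \<Rightarrow> 'a set" where
  "points A = (\<Union>c\<in>A. fst c)"

text \<open>The charts of the maximal atlas generated by \<open>A\<close>.\<close>

definition coord_system ::
    "('a::topological_space, 'n::finite) chart set \<Rightarrow> ('a, 'n) chart \<Rightarrow> bool" where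
  "coord_system A c \<longleftrightarrow> is_chart c \<and> fst c \<subseteq> points A \<and>
     (\<forall>d\<in>A. smooth_transition c d \<and> smooth_transition d c)"

definition smooth_fun_on ::
    "('a::topological_space, 'n::finite) chart set \<Rightarrow> 'a set \<Rightarrow> ('a \<Rightarrow> real) \<Rightarrow> bool" where
  "smooth_fun_on A W f \<longleftrightarrow>
     (\<forall>c. coord_system A c \<longrightarrow> smooth_on (snd c ` (fst c \<inter> W)) (\<lambda>y. f (chart_inv c y)))"

definition smooth_near ::
    "('a::topological_space, 'n::finite) chart set \<Rightarrow> 'a \<Rightarrow> ('a \<Rightarrow> real) \<Rightarrow> bool" where
  "smooth_near A m f \<longleftrightarrow> (\<exists>W. open W \<and> m \<in> W \<and> W \<subseteq> points A \<and> smooth_fun_on A W f)"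

text \<open>\<open>pd c i f\<close> is the partial derivative of \<open>f\<close> with respect to the \<open>i\<close>-th coordinate function
  of \<open>c\<close>, a function on the domain of \<open>c\<close>.\<close>

definition pd :: "('a, 'n::finite) chart \<Rightarrow> 'n \<Rightarrow> ('a \<Rightarrow> real) \<Rightarrow> 'a \<Rightarrow> real" where
  "pd c i f m = partial i (\<lambda>y. f (chart_inv c y)) (snd c m)"

text \<open>
  Tangent vectors at \<open>m\<close> are the derivations at \<open>m\<close> of the functions that are smooth near \<open>m\<close>,
  extended by 0 to all other functions. Locality (equal values on functions agreeing near \<open>m\<close>)
  follows from the Leibniz rule, since functions smooth only near \<open>m\<close> are admitted.
\<close>

type_synonym 'a tvec = "('a \<Rightarrow> real) \<Rightarrow> real"
type_synonym 'a covec = "'a tvec \<Rightarrow> real"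

definition tangent ::
    "('a::topological_space, 'n::finite) chart set \<Rightarrow> 'a \<Rightarrow> 'a tvec set" where
  "tangent A m = {X.
     (\<forall>f. \<not> smooth_near A m f \<longrightarrow> X f = 0) \<and>
     (\<forall>f g a b. smooth_near A m f \<longrightarrow> smooth_near A m g \<longrightarrow>
        X (\<lambda>y. a * f y + b * g y) = a * X f + b * X g) \<and>
     (\<forall>f g. smooth_near A m f \<longrightarrow> smooth_near A m g \<longrightarrow>
        X (\<lambda>y. f y * g y) = f m * X g + g m * X f)}"

definition cotangent ::
    "('a::topological_space, 'n::finite) chart set \<Rightarrow> 'a \<Rightarrow> 'a covec set" where
  "cotangent A m = {\<alpha>.
     (\<forall>X. X \<notin> tangent A m \<longrightarrow> \<alpha> X = 0) \<and>
     (\<forall>X\<in>tangent A m. \<forall>Y\<in>tangent A m. \<forall>a b.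
        \<alpha> (\<lambda>f. a * X f + b * Y f) = a * \<alpha> X + b * \<alpha> Y)}"

definition coord_vec ::
    "('a::topological_space, 'n::finite) chart set \<Rightarrow> ('a, 'n) chart \<Rightarrow> 'n \<Rightarrow> 'a \<Rightarrow> 'a tvec" where
  "coord_vec A c i m = (\<lambda>f. if smooth_near A m f then pd c i f m else 0)"

definition differential ::
    "('a::topological_space, 'n::finite) chart set \<Rightarrow> ('a \<Rightarrow> real) \<Rightarrow> 'a \<Rightarrow> 'a covec" where
  "differential A f m = (\<lambda>X. if X \<in> tangent A m then X f else 0)"

definition coord_covec ::
    "('a::topological_space, 'n::finite) chart set \<Rightarrow> ('a, 'n) chart \<Rightarrow> 'n \<Rightarrow> 'a \<Rightarrow> 'a covec" where
  "coord_covec A c i m = differential A (\<lambda>y. snd c y $ i) m"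

text \<open>
  Alternating \<open>p\<close>-linear maps on a space \<open>S\<close> of real functions (\<open>S\<close> will be a tangent or a
  cotangent space, with pointwise vector operations), as functions on lists of length \<open>p\<close> over \<open>S\<close>.
\<close>

definition alternating_on :: "nat \<Rightarrow> ('b \<Rightarrow> real) set \<Rightarrow> (('b \<Rightarrow> real) list \<Rightarrow> real) \<Rightarrow> bool" where
  "alternating_on p S T \<longleftrightarrow>
     (\<forall>vs. length vs = p \<and> set vs \<subseteq> S \<longrightarrow>
        (\<forall>k<p. \<forall>v\<in>S. \<forall>w\<in>S. \<forall>a b.
           T (vs[k := (\<lambda>z. a * v z + b * w z)]) = a * T (vs[k := v]) + b * T (vs[k := w])) \<and>
        (\<forall>i j. i < j \<and> j < p \<and> vs ! i = vs ! j \<longrightarrow> T vs = 0))"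

text \<open>Exterior product of linear functionals, normalised as
  \<open>(\<alpha>\<^sub>1 \<and> \<dots> \<and> \<alpha>\<^sub>p)(v\<^sub>1, \<dots>, v\<^sub>p) = det (\<alpha>\<^sub>a(v\<^sub>b))\<close>.\<close>

definition wedge :: "('b \<Rightarrow> real) list \<Rightarrow> 'b list \<Rightarrow> real" where
  "wedge \<alpha>s vs = (\<Sum>\<sigma> | \<sigma> permutes {..<length \<alpha>s}.
     of_int (sign \<sigma>) * (\<Prod>a<length \<alpha>s. (\<alpha>s ! a) (vs ! \<sigma> a)))"

definition multi :: "nat \<Rightarrow> 'n::linorder list set" where
  "multi p = {I. length I = p \<and> sorted_wrt (<) I}"

definition wedge_dx ::
    "('a::topological_space, 'n::finite) chart set \<Rightarrow> ('a, 'n) chart \<Rightarrow> 'n list \<Rightarrow> 'a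
      \<Rightarrow> 'a tvec list \<Rightarrow> real" where
  "wedge_dx A c I m = wedge (map (\<lambda>i. coord_covec A c i m) I)"

text \<open>A tangent vector acts on covectors by evaluation.\<close>

definition wedge_vec ::
    "('a::topological_space, 'n::finite) chart set \<Rightarrow> ('a, 'n) chart \<Rightarrow> 'n list \<Rightarrow> 'a
      \<Rightarrow> 'a covec list \<Rightarrow> real" where
  "wedge_vec A c I m = wedge (map (\<lambda>i. (\<lambda>\<alpha>. \<alpha> (coord_vec A c i m))) I)"

definition form_coeff ::
    "('a::topological_space, 'n::finite) chart set \<Rightarrow> ('a, 'n) chart
      \<Rightarrow> ('a \<Rightarrow> 'a tvec list \<Rightarrow> real) \<Rightarrow> 'n list \<Rightarrow> 'a \<Rightarrow> real" where
  "form_coeff A c \<omega> I m = \<omega> m (map (\<lambda>i. coord_vec A c i m) I)"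

definition mvec_coeff ::
    "('a::topological_space, 'n::finite) chart set \<Rightarrow> ('a, 'n) chart
      \<Rightarrow> ('a \<Rightarrow> 'a covec list \<Rightarrow> real) \<Rightarrow> 'n list \<Rightarrow> 'a \<Rightarrow> real" where
  "mvec_coeff A c V I m = V m (map (\<lambda>i. coord_covec A c i m) I)"

definition diff_form ::
    "('a::topological_space, 'n::{finite,linorder}) chart set \<Rightarrow> nat
      \<Rightarrow> ('a \<Rightarrow> 'a tvec list \<Rightarrow> real) \<Rightarrow> bool" where
  "diff_form A p \<omega> \<longleftrightarrow>
     (\<forall>m\<in>points A. alternating_on p (tangent A m) (\<omega> m)) \<and>
     (\<forall>c. coord_system A c \<longrightarrow> (\<forall>I\<in>multi p. smooth_fun_on A (fst c) (form_coeff A c \<omega> I)))"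

definition mvec_field ::
    "('a::topological_space, 'n::{finite,linorder}) chart set \<Rightarrow> nat
      \<Rightarrow> ('a \<Rightarrow> 'a covec list \<Rightarrow> real) \<Rightarrow> bool" where
  "mvec_field A q V \<longleftrightarrow>
     (\<forall>m\<in>points A. alternating_on q (cotangent A m) (V m)) \<and>
     (\<forall>c. coord_system A c \<longrightarrow> (\<forall>I\<in>multi q. smooth_fun_on A (fst c) (mvec_coeff A c V I)))"

definition form_eq_at ::
    "('a::topological_space, 'n::finite) chart set \<Rightarrow> nat \<Rightarrow> 'a
      \<Rightarrow> ('a tvec list \<Rightarrow> real) \<Rightarrow> ('a tvec list \<Rightarrow> real) \<Rightarrow> bool" where
  "form_eq_at A p m \<eta> \<theta> \<longleftrightarrow>
     (\<forall>Xs. length Xs = p \<and> set Xs \<subseteq> tangent A m \<longrightarrow> \<eta> Xs = \<theta> Xs)"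

definition mvec_eq_at ::
    "('a::topological_space, 'n::finite) chart set \<Rightarrow> nat \<Rightarrow> 'a
      \<Rightarrow> ('a covec list \<Rightarrow> real) \<Rightarrow> ('a covec list \<Rightarrow> real) \<Rightarrow> bool" where
  "mvec_eq_at A q m \<eta> \<theta> \<longleftrightarrow>
     (\<forall>\<alpha>s. length \<alpha>s = q \<and> set \<alpha>s \<subseteq> cotangent A m \<longrightarrow> \<eta> \<alpha>s = \<theta> \<alpha>s)"

definition const_coeffs_form ::
    "('a::topological_space, 'n::{finite,linorder}) chart set \<Rightarrow> nat \<Rightarrow> 'a
      \<Rightarrow> ('a \<Rightarrow> 'a tvec list \<Rightarrow> real) \<Rightarrow> bool" where
  "const_coeffs_form A p x \<omega> \<longleftrightarrow>
     (\<exists>c. coord_system A c \<and> x \<in> fst c \<and> snd c x = 0 \<and>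
        (\<forall>I\<in>multi p. form_coeff A c \<omega> I constant_on fst c))"

definition const_coeffs_mvec ::
    "('a::topological_space, 'n::{finite,linorder}) chart set \<Rightarrow> nat \<Rightarrow> 'a
      \<Rightarrow> ('a \<Rightarrow> 'a covec list \<Rightarrow> real) \<Rightarrow> bool" where
  "const_coeffs_mvec A q x V \<longleftrightarrow>
     (\<exists>c. coord_system A c \<and> x \<in> fst c \<and> snd c x = 0 \<and>
        (\<forall>I\<in>multi q. mvec_coeff A c V I constant_on fst c))"

text \<open>Systems of functions \<open>(u\<^sup>1, \<dots>, u\<^sup>n)\<close> are maps into \<open>real^'n\<close>.\<close>

type_synonym ('a, 'n) fun_system = "'a \<Rightarrow> real^'n"

definition jet2 ::
    "('a::topological_space, 'n::finite) chart set \<Rightarrow> 'a \<Rightarrow> ('a, 'n) fun_system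
      \<Rightarrow> 'a \<times> ('a, 'n) fun_system set" where
  "jet2 A m u = (m, {w.
     (\<forall>h. smooth_near A m (\<lambda>y. w y $ h)) \<and> w m = u m \<and>
     (\<forall>c. coord_system A c \<and> m \<in> fst c \<longrightarrow>
        (\<forall>h i. pd c i (\<lambda>y. w y $ h) m = pd c i (\<lambda>y. u y $ h) m) \<and>
        (\<forall>h i j. pd c i (pd c j (\<lambda>y. w y $ h)) m = pd c i (pd c j (\<lambda>y. u y $ h)) m))})"

definition O2 ::
    "('a::topological_space, 'n::{finite,linorder}) chart set
      \<Rightarrow> ('a \<times> ('a, 'n) fun_system set) set" where
  "O2 A = {jet2 A m u | m u. m \<in> points A \<and> (\<forall>h. smooth_near A m (\<lambda>y. u y $ h)) \<and>
     \<not> form_eq_at A CARD('n) m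
         (wedge (map (\<lambda>h. differential A (\<lambda>y. u y $ h) m) (sorted_list_of_set UNIV)))
         (\<lambda>_. 0)}"

definition jacobian ::
    "('a, 'n::finite) chart \<Rightarrow> ('a, 'n) fun_system \<Rightarrow> 'a \<Rightarrow> real^'n^'n" where
  "jacobian c u m = (\<chi> i j. pd c j (\<lambda>y. u y $ i) m)"

text \<open>\<open>Gam c u i j b\<close> is the function with lower indices \<open>i\<close>, \<open>j\<close> and upper index \<open>b\<close>.\<close>

definition Gam ::
    "('a, 'n::finite) chart \<Rightarrow> ('a, 'n) fun_system \<Rightarrow> 'n \<Rightarrow> 'n \<Rightarrow> 'n \<Rightarrow> 'a \<Rightarrow> real" where
  "Gam c u i j b m =
     (\<Sum>h\<in>UNIV. matrix_inv (jacobian c u m) $ b $ h * pd c i (pd c j (\<lambda>y. u y $ h)) m)"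

text \<open>The identities defining the functions \<open>\<Phi> j J\<close> on \<open>W\<close>; they determine these functions there,
  because the \<open>wedge_dx A c J m\<close> (resp. the \<open>wedge_vec A c J m\<close>) with increasing \<open>J\<close> form a basis.\<close>

definition is_Phi_form ::
    "('a::topological_space, 'n::{finite,linorder}) chart set \<Rightarrow> ('a, 'n) chart \<Rightarrow> nat
      \<Rightarrow> ('n list \<Rightarrow> 'a \<Rightarrow> real) \<Rightarrow> 'a set \<Rightarrow> ('a, 'n) fun_system
      \<Rightarrow> ('n \<Rightarrow> 'n list \<Rightarrow> 'a \<Rightarrow> real) \<Rightarrow> bool" where
  "is_Phi_form A c p F W u \<Phi> \<longleftrightarrow>
     (\<forall>m\<in>W. \<forall>j. form_eq_at A p m
        (\<lambda>Xs. \<Sum>J\<in>multi p. \<Phi> j J m * wedge_dx A c J m Xs)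
        (\<lambda>Xs. \<Sum>I\<in>multi p. \<Sum>h<p. \<Sum>i\<in>UNIV.
           Gam c u j i (I ! h) m * F I m * wedge_dx A c (I[h := i]) m Xs))"

definition is_Phi_mvec ::
    "('a::topological_space, 'n::{finite,linorder}) chart set \<Rightarrow> ('a, 'n) chart \<Rightarrow> nat
      \<Rightarrow> ('n list \<Rightarrow> 'a \<Rightarrow> real) \<Rightarrow> 'a set \<Rightarrow> ('a, 'n) fun_system
      \<Rightarrow> ('n \<Rightarrow> 'n list \<Rightarrow> 'a \<Rightarrow> real) \<Rightarrow> bool" where
  "is_Phi_mvec A c q F W u \<Phi> \<longleftrightarrow>
     (\<forall>m\<in>W. \<forall>j. mvec_eq_at A q m
        (\<lambda>\<alpha>s. \<Sum>J\<in>multi q. \<Phi> j J m * wedge_vec A c J m \<alpha>s)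
        (\<lambda>\<alpha>s. \<Sum>I\<in>multi q. \<Sum>h<q. \<Sum>i\<in>UNIV.
           Gam c u j (I ! h) i m * F I m * wedge_vec A c (I[h := i]) m \<alpha>s))"

definition solves_form_system ::
    "('a::topological_space, 'n::{finite,linorder}) chart set \<Rightarrow> ('a, 'n) chart \<Rightarrow> nat
      \<Rightarrow> ('n list \<Rightarrow> 'a \<Rightarrow> real) \<Rightarrow> 'a set \<Rightarrow> ('a, 'n) fun_system \<Rightarrow> bool" where
  "solves_form_system A c p F W u \<longleftrightarrow>
     (\<exists>\<Phi>. is_Phi_form A c p F W u \<Phi> \<and>
        (\<forall>J\<in>multi p. \<forall>j. \<forall>m\<in>W. pd c j (F J) m = \<Phi> j J m))"

definition solves_mvec_system ::
    "('a::topological_space, 'n::{finite,linorder}) chart set \<Rightarrow> ('a, 'n) chart \<Rightarrow> nat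
      \<Rightarrow> ('n list \<Rightarrow> 'a \<Rightarrow> real) \<Rightarrow> 'a set \<Rightarrow> ('a, 'n) fun_system \<Rightarrow> bool" where
  "solves_mvec_system A c q F W u \<longleftrightarrow>
     (\<exists>\<Phi>. is_Phi_mvec A c q F W u \<Phi> \<and>
        (\<forall>J\<in>multi q. \<forall>j. \<forall>m\<in>W. pd c j (F J) m = - \<Phi> j J m))"

end

theory Submission
  imports Defs
begin

text \<open>
  Let \<open>C\<^sub>K\<close> be the coefficients of \<open>\<omega>\<^sub>p\<close> in a coordinate system \<open>u\<close>, for arbitrary index lists \<open>K\<close>. Since
  \<open>\<partial>x\<^sup>i/\<partial>u\<^sup>k\<close> is the inverse of the Jacobian matrix, its derivative with respect to \<open>x\<^sup>j\<close> is
  \<open>- \<Sum>\<^sub>l \<Gamma>\<^sub>j\<^sub>l\<^sup>i \<partial>x\<^sup>l/\<partial>u\<^sup>k\<close>, and differentiating \<open>C\<^sub>K = \<Sum>\<^sub>I F\<^sub>I dx\<^sup>I(\<partial>/\<partial>u\<^sup>K)\<close> gives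
  \<open>\<partial>C\<^sub>K/\<partial>x\<^sup>j = \<Sum>\<^sub>J (\<partial>F\<^sub>J/\<partial>x\<^sup>j - \<Phi>\<^sub>j\<^sub>,\<^sub>J) dx\<^sup>J(\<partial>/\<partial>u\<^sup>K)\<close>. The vectors \<open>\<partial>/\<partial>u\<^sup>k\<close> form a basis, so all \<open>C\<^sub>K\<close> are
  locally constant iff the system (i) holds. For multivector fields the Jacobian matrix itself takes the
  place of its inverse, which accounts for the sign in (ii). Conversely a solution \<open>u\<close> has an invertible
  Jacobian matrix at \<open>x\<close> (this uses that the coordinate vectors span the space of derivations, by
  Hadamard's lemma), and becomes a coordinate system after a translation and shrinking the domain to the
  preimage of a ball.
\<close>

section \<open>Smooth functions on open subsets of Euclidean space\<close>

text \<open>Forms and multivectors share one computation: in both cases the new coefficients are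
  sums of \<open>F I\<close> times minors of a matrix \<open>M\<close>, and along a coordinate line
  \<open>M' = P M\<close> with \<open>P\<close> built from \<open>Gam\<close>. Minors are taken for
  arbitrary index lists, because replacing one entry of an increasing list destroys its order;
  sorting enters only when a vanishing result on increasing lists has to be extended. The unknown
  \<open>u\<close> may have any value at \<open>x\<close>, whereas a chart with constant
  coefficients must be centred there. The comparison is therefore stated for a \<open>u\<close> with
  the same partial derivatives as the chart, which fixes \<open>Gam\<close>. The ball is there
  because vanishing partial derivatives give only local constancy, while the definition asks for
  constancy on the whole coordinate domain: on a convex set the two coincide. Smoothness conditions
  accompany every rule, since \<open>partial\<close> is an unspecified value where no derivative
  exists.\<close>

lemma basis_sum: "(\<Sum>i\<in>UNIV. (v$i) *\<^sub>R axis i 1) = (v::real^'n::finite)"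
  by (simp add: vec_eq_iff axis_def if_distrib cong: if_cong)

lemma has_derivative_imp_DERIV_line:
  fixes f :: "real^'n::finite \<Rightarrow> real"
  assumes "(f has_derivative f') (at y)"
  shows "((\<lambda>t. f (y + t *\<^sub>R axis i 1)) has_real_derivative f' (axis i 1)) (at 0)"
proof -
  have lin: "linear f'"
    using assms has_derivative_linear by blast
  have "((\<lambda>t::real. y + t *\<^sub>R axis i 1) has_derivative (\<lambda>t. t *\<^sub>R axis i 1)) (at 0)"
    by (auto intro!: derivative_eq_intros)
  moreover have "(f has_derivative f') (at (y + 0 *\<^sub>R axis i 1))"
    using assms by simp
  ultimately have "((\<lambda>t. f (y + t *\<^sub>R axis i 1)) has_derivative (\<lambda>t. f' (t *\<^sub>R axis i 1))) (at 0)"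
    using has_derivative_compose[of "\<lambda>t::real. y + t *\<^sub>R axis i 1" "\<lambda>t. t *\<^sub>R axis i 1" 0 UNIV f f'] by simp
  moreover have "(\<lambda>t. f' (t *\<^sub>R axis i 1)) = (*) (f' (axis i 1))"
    using lin by (auto simp: linear_cmul)
  ultimately show ?thesis
    by (simp add: has_field_derivative_def)
qed

lemma partial_eq:
  assumes "(f has_derivative f') (at y)"
  shows "partial i f y = f' (axis i 1)"
  unfolding partial_def
  by (rule DERIV_imp_deriv has_derivative_imp_DERIV_line assms)+

lemma has_derivative_partial:
  assumes "f differentiable (at y)"
  shows "(f has_derivative (\<lambda>v. \<Sum>i\<in>UNIV. v$i * partial i f y)) (at y)"
proof -
  obtain f' where f': "(f has_derivative f') (at y)"
    using assms differentiable_def by blast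
  then have lin: "linear f'"
    using has_derivative_linear by blast
  have "f' v = (\<Sum>i\<in>UNIV. v$i * partial i f y)" for v
  proof -
    have "f' v = f' (\<Sum>i\<in>UNIV. (v$i) *\<^sub>R axis i 1)"
      by (simp add: basis_sum)
    also have "\<dots> = (\<Sum>i\<in>UNIV. v$i * partial i f y)"
      using lin by (simp add: linear_sum linear_cmul partial_eq[OF f'])
    finally show ?thesis .
  qed
  then have "f' = (\<lambda>v. \<Sum>i\<in>UNIV. v$i * partial i f y)"
    by blast
  then show ?thesis using f' by simp
qed

lemma DERIV_line_partial:
  assumes "f differentiable (at y)"
  shows "((\<lambda>t. f (y + t *\<^sub>R axis i 1)) has_real_derivative partial i f y) (at 0)"
proof -
  obtain f' where f': "(f has_derivative f') (at y)"
    using assms differentiable_def by blast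
  show ?thesis
    using has_derivative_imp_DERIV_line[OF f'] by (simp add: partial_eq[OF f'])
qed

lemma eventually_line_in_open:
  fixes y :: "real^'n::finite"
  assumes "open S" "y \<in> S"
  shows "\<forall>\<^sub>F t in nhds (0::real). y + t *\<^sub>R axis i 1 \<in> S"
proof -
  have "open ((\<lambda>t::real. y + t *\<^sub>R axis i 1) -` S)"
    by (intro open_vimage assms continuous_intros)
  then show ?thesis
    unfolding eventually_nhds using assms(2) by force
qed

lemma partial_cong:
  assumes "open S" "y \<in> S" "\<And>z. z \<in> S \<Longrightarrow> f z = g z"
  shows "partial i f y = partial i g y"
  unfolding partial_def
  by (intro deriv_cong_ev eventually_mono[OF eventually_line_in_open[OF assms(1,2)]] refl)
     (use assms in auto)

lemma differentiable_transform_open: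
  assumes "f differentiable (at y)" "open S" "y \<in> S" "\<And>z. z \<in> S \<Longrightarrow> f z = g z"
  shows "g differentiable (at y)"
  using assms has_derivative_transform_within_open unfolding differentiable_def by blast

text \<open>\<open>partial\<close> looks only at nearby values, so openness of \<open>S\<close> lets
  agreement on \<open>S\<close> pass to every higher partial derivative.\<close>

lemma Ck_on_cong:
  assumes "open S" "\<And>z. z \<in> S \<Longrightarrow> f z = g z" "Ck_on k S f"
  shows "Ck_on k S g"
  using assms(2,3)
proof (induction k arbitrary: f g)
  case 0
  then show ?case by (simp cong: continuous_on_cong)
next
  case (Suc k)
  have "g differentiable_on S"
    using Suc.prems assms(1)
    by (auto simp: differentiable_on_eq_differentiable_at intro: differentiable_transform_open)
  moreover have "Ck_on k S (partial i g)" for i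
  proof (rule Suc.IH)
    show "partial i f z = partial i g z" if "z \<in> S" for z
      by (rule partial_cong[OF assms(1) that]) (use Suc.prems in blast)
    show "Ck_on k S (partial i f)"
      using Suc.prems by simp
  qed
  ultimately show ?case by simp
qed

lemma Ck_on_subset:
  assumes "Ck_on k S f" "T \<subseteq> S"
  shows "Ck_on k T f"
  using assms
  by (induction k arbitrary: f) (auto intro: continuous_on_subset differentiable_on_subset)

lemma Ck_on_Suc_imp: "Ck_on (Suc k) S f \<Longrightarrow> Ck_on k S f"
  by (induction k arbitrary: f) (auto intro: differentiable_imp_continuous_on)

text \<open>Lets smoothness of a chart transition be checked near each point, through whichever
  atlas chart covers it.\<close>

lemma Ck_on_local:
  assumes "\<And>y. y \<in> S \<Longrightarrow> \<exists>T. open T \<and> y \<in> T \<and> Ck_on k T f"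
  shows "Ck_on k S f"
  using assms
proof (induction k arbitrary: f)
  case 0
  have "continuous (at y within S) f" if y: "y \<in> S" for y
  proof -
    obtain T where "open T" "y \<in> T" "continuous_on T f"
      using 0[OF y] by auto
    then have "continuous (at y) f"
      using continuous_on_eq_continuous_at by blast
    then show ?thesis by (rule continuous_at_imp_continuous_at_within)
  qed
  then show ?case by (simp add: continuous_on_eq_continuous_within)
next
  case (Suc k)
  have "f differentiable (at y within S)" if y: "y \<in> S" for y
  proof -
    obtain T where "open T" "y \<in> T" "f differentiable_on T"
      using Suc.prems[OF y] by auto
    then show ?thesis
      using differentiable_at_withinI differentiable_on_eq_differentiable_at by blast
  qed
  moreover have "Ck_on k S (partial i f)" for i
    by (rule Suc.IH) (use Suc.prems in fastforce)
  ultimately show ?case by (simp add: differentiable_on_def)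
qed

text \<open>The inductions on \<open>k\<close> know the partial derivatives only through formulas
  valid on \<open>S\<close>; the formula \<open>f'\<close> is what gets checked, and
  \<open>Ck_on_cong\<close> transfers the result.\<close>

lemma Ck_on_SucI:
  assumes "open S" "\<And>y. y \<in> S \<Longrightarrow> f differentiable (at y)"
    and "\<And>i. Ck_on k S (f' i)" "\<And>i y. y \<in> S \<Longrightarrow> partial i f y = f' i y"
  shows "Ck_on (Suc k) S f"
  using assms Ck_on_cong[OF assms(1), of "f' i" "partial i f" for i]
  by (auto simp: differentiable_on_eq_differentiable_at)

lemma Ck_on_SucD:
  assumes "open S" "Ck_on (Suc k) S f" 
  shows "\<And>y. y \<in> S \<Longrightarrow> f differentiable (at y)" "\<And>i. Ck_on k S (partial i f)"
  using assms by (auto simp: differentiable_on_eq_differentiable_at)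

lemma Ck_on_const: "open S \<Longrightarrow> Ck_on k S (\<lambda>_. a)"
proof (induction k arbitrary: a)
  case (Suc k)
  show ?case
    by (rule Ck_on_SucI[where f'="\<lambda>_ _. 0"])
       (use Suc partial_eq[OF has_derivative_const[of a]] in auto)
qed simp

lemma partial_coord: "partial i (\<lambda>y. y $ j) y = (if i = j then 1 else 0)" for y :: "real^'n::finite"
proof -
  have "((\<lambda>y. y $ j) has_derivative (\<lambda>v. v $ j)) (at y)"
    by (rule bounded_linear_imp_has_derivative) (rule bounded_linear_vec_nth)
  from partial_eq[OF this] show ?thesis by (simp add: axis_def)
qed

lemma Ck_on_coord: "open S \<Longrightarrow> Ck_on k S (\<lambda>y. y $ j)" for S :: "(real^'n::finite) set"
proof (cases k)
  case (Suc l)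
  assume "open S"
  have "(\<lambda>y. y $ j) differentiable at y" for y::"real^'n"
    using bounded_linear_imp_differentiable bounded_linear_vec_nth by blast
  then show ?thesis unfolding Suc
    by (intro Ck_on_SucI[where f'="\<lambda>i _. if i = j then 1 else 0"])
       (auto simp: \<open>open S\<close> partial_coord intro: Ck_on_const)
qed (auto intro: continuous_intros)

section \<open>Differentiation rules and closure properties of C^k functions\<close>

lemma partial_add:
  assumes "f differentiable (at y)" "g differentiable (at y)"
  shows "partial i (\<lambda>y. f y + g y) y = partial i f y + partial i g y"
  unfolding partial_def[of i "\<lambda>y. f y + g y"]
  by (rule DERIV_imp_deriv, rule DERIV_add) (rule DERIV_line_partial assms)+

lemma partial_mult:
  assumes "f differentiable (at y)" "g differentiable (at y)"
  shows "partial i (\<lambda>y. f y * g y) y = f y * partial i g y + partial i f y * g y"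
proof -
  have "((\<lambda>t. f (y + t *\<^sub>R axis i 1) * g (y + t *\<^sub>R axis i 1)) has_real_derivative
      f y * partial i g y + partial i f y * g y) (at 0)"
    using DERIV_mult[OF DERIV_line_partial[OF assms(1)] DERIV_line_partial[OF assms(2)], of i i]
    by (simp add: ac_simps)
  then show ?thesis
    unfolding partial_def[of i "\<lambda>y. f y * g y"] by (rule DERIV_imp_deriv)
qed

text \<open>The right-hand side is a product of a constant, \<open>partial i f\<close> and copies of
  \<open>inverse (f y)\<close>, so that \<open>Ck_on_inverse\<close> can combine
  \<open>Ck_on_mult\<close> with its induction hypothesis.\<close>

lemma partial_inverse:
  assumes "f differentiable (at y)" "f y \<noteq> 0"
  shows "partial i (\<lambda>y. inverse (f y)) y = (- 1) * (partial i f y * (inverse (f y) * inverse (f y)))"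
proof -
  have "((\<lambda>t. inverse (f (y + t *\<^sub>R axis i 1))) has_real_derivative
      (- 1) * (partial i f y * (inverse (f y) * inverse (f y)))) (at 0)"
    using DERIV_inverse'[OF DERIV_line_partial[OF assms(1)], of i] assms(2)
    by (simp add: ac_simps)
  then show ?thesis
    unfolding partial_def[of i "\<lambda>y. inverse (f y)"] by (rule DERIV_imp_deriv)
qed

lemma Ck_on_add:
  assumes "open S" "Ck_on k S f" "Ck_on k S g"
  shows "Ck_on k S (\<lambda>y. f y + g y)"
  using assms(2,3)
proof (induction k arbitrary: f g)
  case (Suc k)
  note D = Ck_on_SucD[OF assms(1) Suc.prems(1)] Ck_on_SucD[OF assms(1) Suc.prems(2)]
  show ?case
    by (rule Ck_on_SucI[where f'="\<lambda>i y. partial i f y + partial i g y"])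
       (auto simp: assms(1) D partial_add intro: Suc.IH)
qed (auto intro: continuous_intros)

lemma Ck_on_mult:
  assumes "open S" "Ck_on k S f" "Ck_on k S g"
  shows "Ck_on k S (\<lambda>y. f y * g y)"
  using assms(2,3)
proof (induction k arbitrary: f g)
  case (Suc k)
  note D = Ck_on_SucD[OF assms(1) Suc.prems(1)] Ck_on_SucD[OF assms(1) Suc.prems(2)]
  show ?case
    by (rule Ck_on_SucI[where f'="\<lambda>i y. f y * partial i g y + partial i f y * g y"])
       (auto simp: assms(1) D partial_mult simp del: Ck_on.simps
          intro!: Suc.IH Ck_on_add Ck_on_Suc_imp[OF Suc.prems(1)] Ck_on_Suc_imp[OF Suc.prems(2)])
qed (auto intro: continuous_intros)

lemma Ck_on_inverse:
  assumes "open S" "Ck_on k S f" "\<And>y. y \<in> S \<Longrightarrow> f y \<noteq> 0"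
  shows "Ck_on k S (\<lambda>y. inverse (f y))"
  using assms(2,3)
proof (induction k arbitrary: f)
  case (Suc k)
  note f = Ck_on_SucD[OF assms(1) Suc.prems(1)]
  show ?case
  proof (rule Ck_on_SucI[OF assms(1)])
    show "Ck_on k S (\<lambda>y. (-1) * (partial i f y * (inverse (f y) * inverse (f y))))" for i
      using Suc.IH[OF Ck_on_Suc_imp[OF Suc.prems(1)] Suc.prems(2)] f(2)[of i]
      by (intro Ck_on_mult Ck_on_const assms(1)) auto
    show "(\<lambda>y. inverse (f y)) differentiable (at y)" if "y \<in> S" for y
      by (rule differentiable_inverse f(1) Suc.prems(2) that)+
    show "partial i (\<lambda>y. inverse (f y)) y = (-1) * (partial i f y * (inverse (f y) * inverse (f y)))"
      if "y \<in> S" for i y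
      by (rule partial_inverse f(1) Suc.prems(2) that)+
  qed
qed (auto intro: continuous_intros)

lemma Ck_on_sum:
  assumes "open S" "\<And>i. i \<in> I \<Longrightarrow> Ck_on k S (f i)"
  shows "Ck_on k S (\<lambda>y. \<Sum>i\<in>I. f i y)"
  using assms(2) by (induction I rule: infinite_finite_induct) (auto intro: Ck_on_const Ck_on_add assms(1))

lemma Ck_on_prod:
  assumes "open S" "\<And>i. i \<in> I \<Longrightarrow> Ck_on k S (f i)"
  shows "Ck_on k S (\<lambda>y. \<Prod>i\<in>I. f i y)"
  using assms(2) by (induction I rule: infinite_finite_induct) (auto intro: Ck_on_const Ck_on_mult assms(1))

lemma has_derivative_vec_compI:
  fixes g :: "'a::real_normed_vector \<Rightarrow> real^'m::finite"
  assumes "\<And>j. ((\<lambda>y. g y $ j) has_derivative (\<lambda>v. g' v $ j)) (at y)"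
  shows "(g has_derivative g') (at y)"
proof -
  have "((\<lambda>y. \<Sum>j\<in>UNIV. (g y $ j) *\<^sub>R axis j (1::real)) has_derivative (\<lambda>v. \<Sum>j\<in>UNIV. (g' v $ j) *\<^sub>R axis j 1)) (at y)"
    by (intro has_derivative_sum has_derivative_scaleR_left assms)
  then show ?thesis by (simp add: basis_sum)
qed

lemma
  fixes g :: "real^'n::finite \<Rightarrow> real^'m::finite"
  assumes f: "f differentiable (at (g y))" and g: "\<And>j. (\<lambda>y. g y $ j) differentiable (at y)"
  shows differentiable_compose_vec: "(\<lambda>y. f (g y)) differentiable (at y)"
    and partial_compose: "partial i (\<lambda>y. f (g y)) y = (\<Sum>j\<in>UNIV. partial j f (g y) * partial i (\<lambda>y. g y $ j) y)"
proof -
  have "(g has_derivative (\<lambda>v. \<chi> j. \<Sum>i\<in>UNIV. v$i * partial i (\<lambda>y. g y $ j) y)) (at y)"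
    using g by (intro has_derivative_vec_compI) (simp add: has_derivative_partial)
  from has_derivative_compose[OF this has_derivative_partial[OF f]]
  have *: "((\<lambda>y. f (g y)) has_derivative (\<lambda>v. \<Sum>j\<in>UNIV. (\<Sum>i\<in>UNIV. v$i * partial i (\<lambda>y. g y $ j) y) * partial j f (g y))) (at y)"
    by simp
  then show "(\<lambda>y. f (g y)) differentiable (at y)"
    by (rule differentiableI)
  show "partial i (\<lambda>y. f (g y)) y = (\<Sum>j\<in>UNIV. partial j f (g y) * partial i (\<lambda>y. g y $ j) y)"
    unfolding partial_eq[OF *] by (simp add: axis_def if_distrib[where f="\<lambda>x. x * _"] mult.commute cong: if_cong)
qed

lemma Ck_on_imp_continuous: "Ck_on k S f \<Longrightarrow> continuous_on S f"
  by (cases k) (auto intro: differentiable_imp_continuous_on)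

text \<open>The chain rule puts \<open>partial j f\<close> in the place of \<open>f\<close>, so the
  induction varies \<open>f\<close> and keeps \<open>g\<close> fixed.\<close>

lemma Ck_on_compose:
  fixes g :: "real^'n::finite \<Rightarrow> real^'m::finite"
  assumes "open S" "open T" "g ` S \<subseteq> T" "Ck_on k T f" "\<And>j. Ck_on k S (\<lambda>y. g y $ j)"
  shows "Ck_on k S (\<lambda>y. f (g y))"
  using assms(4,5)
proof (induction k arbitrary: f)
  case 0
  have "continuous_on S (\<lambda>y. \<chi> j. g y $ j)"
    by (rule continuous_on_vec_lambda) (use 0(2) in simp)
  then have g: "continuous_on S g" by simp
  have "continuous_on T f" using 0(1) by simp
  from continuous_on_compose2[OF this g assms(3)] show ?case by simp
next
  case (Suc k)
  note f = Ck_on_SucD[OF assms(2) Suc.prems(1)] and g = Ck_on_SucD[OF assms(1) Suc.prems(2)]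
  have T: "g y \<in> T" if "y \<in> S" for y
    using assms(3) that by blast
  show ?case
  proof (rule Ck_on_SucI[OF assms(1)])
    show "(\<lambda>y. f (g y)) differentiable (at y)" if "y \<in> S" for y
      by (rule differentiable_compose_vec[of f g y, OF f(1)[OF T[OF that]] g(1)[OF that]])
    show "Ck_on k S (\<lambda>y. \<Sum>j\<in>UNIV. partial j f (g y) * partial i (\<lambda>y. g y $ j) y)" for i
    proof -
      have 1: "Ck_on k S (\<lambda>y. partial j f (g y))" for j
        using Suc.IH[of "partial j f", OF f(2) Ck_on_Suc_imp[OF Suc.prems(2)]] .
      have 2: "Ck_on k S (partial i (\<lambda>y. g y $ j))" for j
        by (rule g(2))
      show ?thesis
        by (rule Ck_on_sum[OF assms(1)]) (rule Ck_on_mult[OF assms(1) 1 2])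
    qed
    show "partial i (\<lambda>y. f (g y)) y = (\<Sum>j\<in>UNIV. partial j f (g y) * partial i (\<lambda>y. g y $ j) y)"
      if "y \<in> S" for i y
      by (rule partial_compose[of f g y, OF f(1)[OF T[OF that]] g(1)[OF that]])
  qed
qed


lemma smooth_on_differentiable:
  assumes "smooth_on S f" "open S" "y \<in> S"
  shows "f differentiable (at y)"
  by (rule Ck_on_SucD(1)[of S 0]) (use assms in \<open>auto simp only: smooth_on_def\<close>)

lemma smooth_on_partial: "smooth_on S f \<Longrightarrow> smooth_on S (partial i f)"
  unfolding smooth_on_def by (meson Ck_on.simps(2))

lemma smooth_on_cong:
  assumes "open S" "\<And>z. z \<in> S \<Longrightarrow> f z = g z" "smooth_on S f"
  shows "smooth_on S g"
  unfolding smooth_on_def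
proof
  show "Ck_on k S g" for k
    by (rule Ck_on_cong[of S f g]) (use assms in \<open>auto simp only: smooth_on_def\<close>)
qed

lemma smooth_on_subset: "smooth_on S f \<Longrightarrow> T \<subseteq> S \<Longrightarrow> smooth_on T f"
  by (simp only: smooth_on_def) (meson Ck_on_subset)

lemma smooth_on_local:
  assumes "\<And>y. y \<in> S \<Longrightarrow> \<exists>T. open T \<and> y \<in> T \<and> smooth_on T f"
  shows "smooth_on S f"
  unfolding smooth_on_def
proof (intro allI Ck_on_local)
  show "\<exists>T. open T \<and> y \<in> T \<and> Ck_on k T f" if "y \<in> S" for k y
    using assms[OF that] unfolding smooth_on_def by metis
qed

lemma smooth_on_const: "open S \<Longrightarrow> smooth_on S (\<lambda>_. a)"
  by (simp add: smooth_on_def Ck_on_const)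

lemma smooth_on_coord: "open S \<Longrightarrow> smooth_on S (\<lambda>y. y $ i)"
  by (simp add: smooth_on_def Ck_on_coord)

lemma smooth_on_add: "open S \<Longrightarrow> smooth_on S f \<Longrightarrow> smooth_on S g \<Longrightarrow> smooth_on S (\<lambda>y. f y + g y)"
  by (simp add: smooth_on_def Ck_on_add)

lemma smooth_on_mult: "open S \<Longrightarrow> smooth_on S f \<Longrightarrow> smooth_on S g \<Longrightarrow> smooth_on S (\<lambda>y. f y * g y)"
  by (simp add: smooth_on_def Ck_on_mult)

lemma smooth_on_compose:
  fixes g :: "real^'n::finite \<Rightarrow> real^'m::finite"
  assumes "open S" "open T" "g ` S \<subseteq> T" "smooth_on T f" "\<And>j. smooth_on S (\<lambda>y. g y $ j)"
  shows "smooth_on S (\<lambda>y. f (g y))"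
  unfolding smooth_on_def
proof
  fix k
  have "Ck_on k T f" "\<And>j. Ck_on k S (\<lambda>y. g y $ j)"
    using assms(4,5) by (simp_all only: smooth_on_def)
  from Ck_on_compose[OF assms(1-3) this] show "Ck_on k S (\<lambda>y. f (g y))" .
qed

section \<open>Hadamard's lemma and the smooth inverse function theorem\<close>

text \<open>With \<open>k = 0\<close> and \<open>h = partial i f\<close> this is the factor in
  Hadamard's lemma. The weight \<open>t ^ k\<close> makes the family closed under differentiation:
  each derivative under the integral sign produces one more factor \<open>t\<close>.\<close>

definition cone_integral :: "real^'n::finite \<Rightarrow> nat \<Rightarrow> (real^'n \<Rightarrow> real) \<Rightarrow> real^'n \<Rightarrow> real" where
  "cone_integral a k h y = integral (cbox 0 1) (\<lambda>t. t ^ k * h (a + t *\<^sub>R (y - a)))"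

lemma convex_ray:
  fixes a y :: "'b::real_vector"
  assumes "convex S" "a \<in> S" "y \<in> S" "t \<in> cbox (0::real) 1"
  shows "a + t *\<^sub>R (y - a) \<in> S"
proof -
  have "(1 - t) *\<^sub>R a + t *\<^sub>R y \<in> S"
    by (rule convexD_alt) (use assms in \<open>auto\<close>)
  then show ?thesis by (simp add: algebra_simps)
qed

lemma continuous_on_ray:
  fixes a :: "'b::real_normed_vector"
  assumes "convex S" "a \<in> S" "continuous_on S h"
  shows "continuous_on (S \<times> cbox 0 1) (\<lambda>(y, t). t ^ k * h (a + t *\<^sub>R (y - a)) :: real)"
  unfolding case_prod_beta
proof (rule continuous_on_mult)
  show "continuous_on (S \<times> cbox 0 1) (\<lambda>p. h (a + snd p *\<^sub>R (fst p - a)))"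
    by (rule continuous_on_compose2[OF assms(3)])
       (auto intro!: continuous_intros convex_ray[OF assms(1,2)] simp del: cbox_interval)
qed (intro continuous_intros)

text \<open>Differentiation under the integral sign; convexity keeps the segment from
  \<open>a\<close> to each point inside \<open>S\<close>.\<close>

lemma cone_integral_differentiable:
  fixes a :: "real^'n::finite"
  assumes S: "open S" "convex S" "a \<in> S" and h: "Ck_on (Suc 0) S h" and y: "y \<in> S"
  shows "cone_integral a k h differentiable (at y)"
    and "partial i (cone_integral a k h) y = cone_integral a (Suc k) (partial i h) y"
proof -
  note D = Ck_on_SucD[OF S(1) h]
  \<comment> \<open>\<open>leibniz_rule\<close> needs a derivative that is continuous as a map into
    bounded linear functionals; a combination of fixed coordinate functionals reduces this to
    continuity of the coefficients.\<close>
  define h' where "h' z t = (\<Sum>j\<in>UNIV. (t ^ Suc k * partial j h (a + t *\<^sub>R (z - a))) *\<^sub>R blinfun_inner_left (axis j (1::real)))"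
    for z and t :: real
  have h': "blinfun_apply (h' z t) v = (\<Sum>j\<in>UNIV. (t ^ Suc k * partial j h (a + t *\<^sub>R (z - a))) * v $ j)"
    for z t and v :: "real^'n"
    by (simp add: h'_def blinfun.sum_left blinfun.scaleR_left inner_axis)
  have cont: "continuous_on S h"
    using D(1) by (auto intro!: continuous_at_imp_continuous_on differentiable_imp_continuous_within)
  have cont': "continuous_on (S \<times> cbox 0 1) (\<lambda>(z, t). h' z t)"
    unfolding h'_def case_prod_beta
    by (intro continuous_on_sum continuous_on_scaleR continuous_on_const
        continuous_on_ray[OF S(2,3), unfolded case_prod_beta])
       (use D(2) in simp)
  have deriv: "((\<lambda>z. t ^ k * h (a + t *\<^sub>R (z - a))) has_derivative blinfun_apply (h' z t)) (at z within S)"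
    if "z \<in> S" "t \<in> cbox 0 1" for z t
  proof -
    have "((\<lambda>z. a + t *\<^sub>R (z - a)) has_derivative (\<lambda>v. t *\<^sub>R v)) (at z)"
      by (auto intro!: derivative_eq_intros)
    from has_derivative_compose[OF this has_derivative_partial[OF D(1)[OF convex_ray[OF S(2,3) that]]]]
    have "((\<lambda>z. h (a + t *\<^sub>R (z - a))) has_derivative
        (\<lambda>v. \<Sum>j\<in>UNIV. (t *\<^sub>R v) $ j * partial j h (a + t *\<^sub>R (z - a)))) (at z)" .
    from has_derivative_mult_right[OF this, of "t ^ k"]
    have "((\<lambda>z. t ^ k * h (a + t *\<^sub>R (z - a))) has_derivative blinfun_apply (h' z t)) (at z)"
      by (rule has_derivative_eq_rhs) (auto simp: h' sum_distrib_left ac_simps)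
    then show ?thesis by (rule has_derivative_at_withinI)
  qed
  have int: "(\<lambda>t. t ^ k * h (a + t *\<^sub>R (z - a))) integrable_on cbox 0 1" if "z \<in> S" for z
    by (rule integrable_continuous)
       (auto intro!: continuous_intros continuous_on_compose2[OF cont] convex_ray[OF S(2,3) that] simp del: cbox_interval)
  have "((\<lambda>z. integral (cbox 0 1) (\<lambda>t. t ^ k * h (a + t *\<^sub>R (z - a)))) has_derivative integral (cbox 0 1) (h' y)) (at y within S)"
    by (rule leibniz_rule[OF deriv int cont' y S(2)])
  then have *: "(cone_integral a k h has_derivative integral (cbox 0 1) (h' y)) (at y)"
    unfolding cone_integral_def using at_within_open[OF y S(1)] by simp
  then show "cone_integral a k h differentiable (at y)"
    by (rule differentiableI)
  have "h' y integrable_on cbox 0 1"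
  proof (rule integrable_continuous)
    show "continuous_on (cbox 0 1) (h' y)"
    proof -
      have "continuous_on (cbox 0 1) (\<lambda>t. case (y, t) of (z, t) \<Rightarrow> h' z t)"
        by (rule continuous_on_compose2[OF cont', of _ "Pair y"])
           (use y in \<open>auto intro!: continuous_on_Pair[of _ "\<lambda>_. y" "\<lambda>t. t"] simp del: cbox_interval\<close>)
      then show ?thesis by simp
    qed
  qed
  then have "integral (cbox 0 1) (h' y) (axis i 1) = integral (cbox 0 1) (\<lambda>t. h' y t (axis i 1))"
    by (rule blinfun_apply_integral)
  also have "\<dots> = cone_integral a (Suc k) (partial i h) y"
    by (simp add: cone_integral_def h' axis_def if_distrib[where f="\<lambda>x. _ * x"] cong: if_cong)
  finally show "partial i (cone_integral a k h) y = cone_integral a (Suc k) (partial i h) y"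
    by (simp add: partial_eq[OF *])
qed

lemma Ck_on_cone_integral:
  assumes S: "open S" "convex S" "a \<in> S" and h: "Ck_on l S h"
  shows "Ck_on l S (cone_integral a k h)"
  using h
proof (induction l arbitrary: h k)
  case 0
  then have "continuous_on S (\<lambda>y. integral (cbox 0 1) (\<lambda>t. t ^ k * h (a + t *\<^sub>R (y - a))))"
    by (intro integral_continuous_on_param continuous_on_ray S) simp
  then show ?case by (simp add: cone_integral_def[abs_def])
next
  case (Suc l)
  have 1: "Ck_on (Suc 0) S h"
    using Suc.prems by (auto intro: Ck_on_imp_continuous)
  show ?case
  proof (rule Ck_on_SucI[OF S(1)])
    show "Ck_on l S (cone_integral a (Suc k) (partial i h))" for i
      by (rule Suc.IH) (use Suc.prems in simp)
  qed (use cone_integral_differentiable[OF S 1] in auto)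
qed

lemma smooth_on_cone_integral:
  assumes "open S" "convex S" "a \<in> S" and "smooth_on S h"
  shows "smooth_on S (cone_integral a k h)"
  using assms Ck_on_cone_integral unfolding smooth_on_def by blast

lemma cone_integral_center: "cone_integral a 0 h a = h a"
  by (simp add: cone_integral_def)

text \<open>The fundamental theorem of calculus along the segment from \<open>a\<close> to
  \<open>y\<close>; the factors \<open>y $ i - a $ i\<close> do not depend on \<open>t\<close> and
  come out of the integral.\<close>

lemma hadamard:
  assumes S: "open S" "convex S" "a \<in> S" and f: "smooth_on S f" and y: "y \<in> S"
  shows "f y = f a + (\<Sum>i\<in>UNIV. (y $ i - a $ i) * cone_integral a 0 (partial i f) y)"
proof -
  have ray: "a + t *\<^sub>R (y - a) \<in> S" if "t \<in> cbox 0 1" for t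
    by (rule convex_ray[OF S(2,3) y that])
  have int: "(\<lambda>t. partial i f (a + t *\<^sub>R (y - a))) integrable_on cbox 0 1" for i
  proof (rule integrable_continuous)
    have "continuous_on S (partial i f)"
      using smooth_on_partial[OF f] Ck_on_imp_continuous unfolding smooth_on_def by blast
    then show "continuous_on (cbox 0 1) (\<lambda>t. partial i f (a + t *\<^sub>R (y - a)))"
      by (rule continuous_on_compose2) (use ray in \<open>auto intro!: continuous_intros simp del: cbox_interval\<close>)
  qed
  have "((\<lambda>t. f (a + t *\<^sub>R (y - a))) has_vector_derivative
      (\<Sum>i\<in>UNIV. (y $ i - a $ i) * partial i f (a + t *\<^sub>R (y - a)))) (at t within {0..1})"
    if "t \<in> {0..1}" for t
  proof -
    have 1: "((\<lambda>t. a + t *\<^sub>R (y - a)) has_derivative (\<lambda>s. s *\<^sub>R (y - a))) (at t)"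
      by (auto intro!: derivative_eq_intros)
    have 2: "f differentiable (at (a + t *\<^sub>R (y - a)))"
      by (rule smooth_on_differentiable[OF f S(1) ray]) (use that in simp)
    have "((\<lambda>t. f (a + t *\<^sub>R (y - a))) has_derivative
        (\<lambda>s. \<Sum>i\<in>UNIV. (s *\<^sub>R (y - a)) $ i * partial i f (a + t *\<^sub>R (y - a)))) (at t)"
      by (rule has_derivative_compose[OF 1 has_derivative_partial[OF 2]])
    then have "((\<lambda>t. f (a + t *\<^sub>R (y - a))) has_derivative
        (\<lambda>s. s *\<^sub>R (\<Sum>i\<in>UNIV. (y $ i - a $ i) * partial i f (a + t *\<^sub>R (y - a))))) (at t)"
      by (rule has_derivative_eq_rhs) (simp add: sum_distrib_left ac_simps)
    then show ?thesis
      unfolding has_vector_derivative_def by (rule has_derivative_at_withinI)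
  qed
  then have 1: "((\<lambda>t. \<Sum>i\<in>UNIV. (y $ i - a $ i) * partial i f (a + t *\<^sub>R (y - a))) has_integral
      (f (a + 1 *\<^sub>R (y - a)) - f (a + 0 *\<^sub>R (y - a)))) {0..1}"
    by (intro fundamental_theorem_of_calculus) auto
  have 2: "((\<lambda>t. \<Sum>i\<in>UNIV. (y $ i - a $ i) * partial i f (a + t *\<^sub>R (y - a))) has_integral
      (\<Sum>i\<in>UNIV. (y $ i - a $ i) * cone_integral a 0 (partial i f) y)) {0..1}"
    unfolding cone_integral_def
    by (intro has_integral_sum has_integral_mult_right) (use int in \<open>auto simp: has_integral_iff\<close>)
  from has_integral_unique[OF 2 1] show ?thesis by simp
qed

section \<open>Smoothness of the local inverse\<close>

lemma Ck_on_det: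
  fixes M :: "real^'m::finite \<Rightarrow> real^'n::finite^'n"
  assumes "open S" "\<And>i j. Ck_on k S (\<lambda>y. M y $ i $ j)"
  shows "Ck_on k S (\<lambda>y. det (M y))"
  unfolding det_def
  by (rule Ck_on_sum[OF assms(1)], rule Ck_on_mult[OF assms(1) Ck_on_const[OF assms(1)]],
      rule Ck_on_prod[OF assms(1)], rule assms(2))

text \<open>Bootstrapping: the Jacobian matrix of \<open>g\<close> at \<open>y\<close> is the
  inverse of that of \<open>f\<close> at \<open>g y\<close>, so by Cramer's rule its entries are
  rational expressions in the partial derivatives of \<open>f\<close> composed with
  \<open>g\<close>. If \<open>g\<close> is C^k, so are these entries, and \<open>g\<close> is
  C^(k+1).\<close>

lemma smooth_on_right_inverse:
  fixes f g :: "real^'n::finite \<Rightarrow> real^'n"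
  assumes S: "open S" and V: "open V" and f: "\<And>i. smooth_on S (\<lambda>z. f z $ i)"
    and g: "g ` V \<subseteq> S" "\<And>y. y \<in> V \<Longrightarrow> f (g y) = y"
    and g': "\<And>y j. y \<in> V \<Longrightarrow> (\<lambda>y. g y $ j) differentiable (at y)"
  shows "smooth_on V (\<lambda>y. g y $ j)"
proof -
  define J where "J y = (\<chi> i j. partial j (\<lambda>z. f z $ i) (g y))" for y
  define D where "D y = (\<chi> j k. partial k (\<lambda>y. g y $ j) y)" for y
  have JD: "J y ** D y = mat 1" if y: "y \<in> V" for y
  proof -
    have gS: "g y \<in> S" using g(1) y by blast
    have "(\<Sum>j\<in>UNIV. partial j (\<lambda>z. f z $ i) (g y) * partial k (\<lambda>y. g y $ j) y) = (if i = k then 1 else 0)" for i k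
    proof -
      have "(\<Sum>j\<in>UNIV. partial j (\<lambda>z. f z $ i) (g y) * partial k (\<lambda>y. g y $ j) y) = partial k (\<lambda>y. f (g y) $ i) y"
        by (rule partial_compose[of "\<lambda>z. f z $ i" g y, symmetric])
           (auto intro: smooth_on_differentiable[OF f S gS] g' y)
      also have "\<dots> = partial k (\<lambda>y. y $ i) y"
        by (rule partial_cong[OF V y]) (use g(2) in simp)
      finally show ?thesis by (auto simp: partial_coord)
    qed
    then show ?thesis
      by (simp add: vec_eq_iff J_def D_def matrix_matrix_mult_def mat_def)
  qed
  have det: "det (J y) \<noteq> 0" if "y \<in> V" for y
    using JD[OF that] by (metis det_I det_mul mult_zero_left zero_neq_one)
  \<comment> \<open>\<open>det (N l k y)\<close> is the numerator in Cramer's rule for the entry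
    \<open>(l, k)\<close> of the inverse of \<open>J y\<close>.\<close>
  define N where "N l k y = (\<chi> i j. if j = l then axis k 1 $ i else J y $ i $ j)" for l k y
  have cr: "partial k (\<lambda>y. g y $ l) y = det (N l k y) * inverse (det (J y))" if y: "y \<in> V" for l k y
  proof -
    have "J y *v (D y *v axis k 1) = axis k 1"
      by (simp add: matrix_vector_mul_assoc JD[OF y])
    then have "D y *v axis k 1 = (\<chi> l. det (\<chi> i j. if j = l then axis k 1 $ i else J y $ i $ j) / det (J y))"
      using cramer[OF det[OF y]] by blast
    then have "(D y *v axis k 1) $ l = det (N l k y) / det (J y)"
      by (simp add: N_def)
    moreover have "(D y *v axis k 1) $ l = D y $ l $ k"
      by (simp add: matrix_vector_mult_def axis_def if_distrib[where f="\<lambda>x. _ * x"] cong: if_cong)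
    ultimately show ?thesis by (simp add: D_def divide_inverse)
  qed
  have "Ck_on k V (\<lambda>y. g y $ j)" for k j
  proof (induction k arbitrary: j)
    case 0
    have "continuous_on V (\<lambda>y. g y $ j)"
      using g' by (auto intro!: continuous_at_imp_continuous_on differentiable_imp_continuous_within)
    then show ?case by simp
  next
    case (Suc k)
    have J: "Ck_on k V (\<lambda>y. J y $ a $ b)" for a b
    proof -
      have "Ck_on k S (partial b (\<lambda>z. f z $ a))"
        using smooth_on_partial[OF f] unfolding smooth_on_def by blast
      from Ck_on_compose[OF V S g(1) this Suc.IH] show ?thesis
        by (simp add: J_def)
    qed
    have N: "Ck_on k V (\<lambda>y. N j l y $ a $ b)" for l a b
      using J[of a b] Ck_on_const[OF V] by (cases "b = j") (auto simp: N_def)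
    show ?case
    proof (rule Ck_on_SucI[OF V g'])
      show "Ck_on k V (\<lambda>y. det (N j l y) * inverse (det (J y)))" for l
        using Ck_on_mult[OF V Ck_on_det[OF V N] Ck_on_inverse[OF V Ck_on_det[OF V J] det]] .
      show "partial i (\<lambda>y. g y $ j) y = det (N j i y) * inverse (det (J y))" if "y \<in> V" for i y
        by (rule cr[OF that])
    qed
  qed
  then show ?thesis by (simp add: smooth_on_def)
qed

lemma matrix_inv_eq:
  fixes A B :: "real^'n::finite^'n"
  assumes "A ** B = mat 1"
  shows "matrix_inv A = B"
proof -
  have "B ** A = mat 1"
    using assms matrix_left_right_inverse by blast
  then have "A ** matrix_inv A = mat 1"
    unfolding matrix_inv_def using someI[of "\<lambda>C. A ** C = mat 1 \<and> C ** A = mat 1" B] assms by blast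
  then have "(B ** A) ** matrix_inv A = B"
    by (simp add: matrix_mul_assoc[symmetric] matrix_mul_rid)
  then show ?thesis
    by (simp add: \<open>B ** A = mat 1\<close> matrix_mul_lid)
qed

theorem smooth_inverse_function:
  fixes f :: "real^'n::finite \<Rightarrow> real^'n"
  assumes S: "open S" and f: "\<And>i. smooth_on S (\<lambda>z. f z $ i)" and a: "a \<in> S"
    and det: "det (\<chi> i j. partial j (\<lambda>z. f z $ i) a) \<noteq> 0"
  obtains U V g where "open U" "U \<subseteq> S" "a \<in> U" "open V" "homeomorphism U V f g"
    "\<And>j. smooth_on V (\<lambda>y. g y $ j)"
proof -
  \<comment> \<open>Elementary matrices as bounded linear maps: expressed in them, the derivative is
    continuous into the operator space as soon as the partial derivatives are continuous.\<close>
  define E where "E i j = Blinfun (\<lambda>v::real^'n. (v $ j) *\<^sub>R (axis i 1 :: real^'n))" for i j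
  have E: "blinfun_apply (E i j) v = (v $ j) *\<^sub>R axis i 1" for i j v
    unfolding E_def
    by (subst bounded_linear_Blinfun_apply)
       (auto intro: bounded_linear_scaleR_left bounded_linear_compose[OF _ bounded_linear_vec_nth])
  define f' where "f' z = (\<Sum>i\<in>UNIV. \<Sum>j\<in>UNIV. partial j (\<lambda>z. f z $ i) z *\<^sub>R E i j)" for z
  have f': "blinfun_apply (f' z) v = (\<chi> i j. partial j (\<lambda>z. f z $ i) z) *v v" for z v
  proof -
    have "(\<Sum>i\<in>UNIV. \<Sum>j\<in>UNIV. partial j (\<lambda>z. f z $ i) z * v $ j * axis i 1 $ h) =
        (\<Sum>i\<in>UNIV. if i = h then \<Sum>j\<in>UNIV. partial j (\<lambda>z. f z $ i) z * v $ j else 0)" for h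
      by (intro sum.cong) (auto simp: axis_def)
    then show ?thesis
      by (simp add: f'_def blinfun.sum_left blinfun.scaleR_left E vec_eq_iff matrix_vector_mult_def)
  qed
  have deriv: "(f has_derivative blinfun_apply (f' z)) (at z)" if "z \<in> S" for z
  proof (rule has_derivative_vec_compI)
    fix i
    have "(\<lambda>z. f z $ i) differentiable (at z)"
      by (rule smooth_on_differentiable[OF f S that])
    then show "((\<lambda>z. f z $ i) has_derivative (\<lambda>v. blinfun_apply (f' z) v $ i)) (at z)"
      using has_derivative_partial by (auto simp: f' matrix_vector_mult_def ac_simps)
  qed
  have cont: "continuous_on S f'"
    unfolding f'_def
  proof (intro continuous_on_sum continuous_on_scaleR continuous_on_const)
    show "continuous_on S (partial j (\<lambda>z. f z $ i))" for i j
      using smooth_on_partial[OF f] Ck_on_imp_continuous unfolding smooth_on_def by blast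
  qed
  obtain B where B: "B ** (\<chi> i j. partial j (\<lambda>z. f z $ i) a) = mat 1"
    using det invertible_det_nz invertible_left_inverse by blast
  define invf where "invf = Blinfun (\<lambda>v. B *v v)"
  have "invf o\<^sub>L f' a = id_blinfun"
    by (rule blinfun_eqI)
       (simp add: invf_def bounded_linear_Blinfun_apply f' matrix_vector_mul_assoc B)
  then obtain U V g g' where *: "open U" "U \<subseteq> S" "a \<in> U" "open V" "homeomorphism U V f g"
    and g': "\<And>y. y \<in> V \<Longrightarrow> (g has_derivative g' y) (at y)"
    using inverse_function_theorem[OF S deriv cont a] by metis
  have "smooth_on V (\<lambda>y. g y $ j)" for j
  proof (rule smooth_on_right_inverse[OF S \<open>open V\<close> f])
    show "g ` V \<subseteq> S" "\<And>y. y \<in> V \<Longrightarrow> f (g y) = y"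
      using * by (auto simp: homeomorphism_def)
    show "(\<lambda>y. g y $ j) differentiable (at y)" if "y \<in> V" for y j
      using bounded_linear.has_derivative[OF bounded_linear_vec_nth g'[OF that]] by (rule differentiableI)
  qed
  with * show ?thesis by (rule that)
qed

section \<open>Minors and exterior products\<close>

text \<open>Used mostly with the functionals \<open>\<lambda>i v. v i\<close>: evaluating coordinate
  functionals on component vectors gives a minor of the component matrix.\<close>

lemma wedge_map_map:
  "wedge (map f I) (map g K) = wedge (map (\<lambda>i k. f i (g k)) I) K" if "length I = length K"
  unfolding wedge_def
  by (intro sum.cong refl arg_cong2[where f="(*)"] prod.cong)
     (use that in \<open>auto simp: permutes_in_image[of _ "{..<length K}", simplified]\<close>)

lemma wedge_cong:
  assumes "length I = length K" "\<And>i k. i \<in> set I \<Longrightarrow> k \<in> set K \<Longrightarrow> f i k = g i k"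
  shows "wedge (map f I) K = wedge (map g I) K"
  unfolding wedge_def
proof (intro sum.cong arg_cong2[where f="(*)"] prod.cong)
  fix \<sigma> a assume "\<sigma> \<in> {\<sigma>. \<sigma> permutes {..<length (map g I)}}" "a \<in> {..<length (map g I)}"
  then have "\<sigma> a < length K" "a < length I"
    using permutes_in_image[of \<sigma> "{..<length I}" a] assms(1) by auto
  then show "(map f I ! a) (K ! \<sigma> a) = (map g I ! a) (K ! \<sigma> a)"
    using assms(2) by simp
qed auto

text \<open>The determinant of the transpose, by summing over inverse permutations. Each argument
  now sits in a factor of its own, the form in which sums in the arguments can be multiplied
  out.\<close>

lemma wedge_transpose:
  assumes "length vs = length \<alpha>s"
  shows "wedge \<alpha>s vs = (\<Sum>\<sigma> | \<sigma> permutes {..<length \<alpha>s}.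
     of_int (sign \<sigma>) * (\<Prod>b<length \<alpha>s. (\<alpha>s ! \<sigma> b) (vs ! b)))"
proof -
  let ?S = "{..<length \<alpha>s}"
  have "wedge \<alpha>s vs = (\<Sum>\<sigma> | \<sigma> permutes ?S. of_int (sign (inv \<sigma>)) * (\<Prod>a\<in>?S. (\<alpha>s ! a) (vs ! inv \<sigma> a)))"
    unfolding wedge_def by (rule sum_permutations_inverse)
  also have "\<dots> = (\<Sum>\<sigma> | \<sigma> permutes ?S. of_int (sign \<sigma>) * (\<Prod>b\<in>?S. (\<alpha>s ! \<sigma> b) (vs ! b)))"
  proof (rule sum.cong[OF refl])
    fix \<sigma> assume "\<sigma> \<in> {\<sigma>. \<sigma> permutes ?S}"
    then have \<sigma>: "\<sigma> permutes ?S" by simp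
    have "(\<Prod>a\<in>?S. (\<alpha>s ! a) (vs ! inv \<sigma> a)) = (\<Prod>b\<in>?S. (\<alpha>s ! \<sigma> b) (vs ! inv \<sigma> (\<sigma> b)))"
      by (rule prod.permute[OF \<sigma>, unfolded o_def])
    moreover have "sign (inv \<sigma>) = sign \<sigma>"
      using \<sigma> by (intro sign_inverse) (auto simp: permutation_permutes)
    ultimately show "of_int (sign (inv \<sigma>)) * (\<Prod>a\<in>?S. (\<alpha>s ! a) (vs ! inv \<sigma> a)) =
        of_int (sign \<sigma>) * (\<Prod>b\<in>?S. (\<alpha>s ! \<sigma> b) (vs ! b))"
      using \<sigma> by (simp add: permutes_inverses)
  qed
  finally show ?thesis .
qed

text \<open>Reindexing by \<open>\<pi> \<circ> \<sigma>\<close> splits off the sign of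
  \<open>\<pi>\<close>, whose square is 1.\<close>

lemma wedge_permute:
  assumes \<pi>: "\<pi> permutes {..<length vs}" and len: "length \<alpha>s = length vs"
  shows "wedge \<alpha>s (permute_list \<pi> vs) = of_int (sign \<pi>) * wedge \<alpha>s vs"
proof -
  let ?S = "{..<length vs}"
  have p: "permutation \<sigma>" if "\<sigma> permutes ?S" for \<sigma>
    using that by (auto simp: permutation_permutes)
  have "wedge \<alpha>s (permute_list \<pi> vs) =
      (\<Sum>\<sigma> | \<sigma> permutes ?S. of_int (sign \<sigma>) * (\<Prod>a\<in>?S. (\<alpha>s ! a) (vs ! (\<pi> \<circ> \<sigma>) a)))"
    unfolding wedge_def len
    by (intro sum.cong refl arg_cong2[where f="(*)"] prod.cong)
       (use \<pi> permutes_in_image in \<open>fastforce simp: permute_list_nth\<close>)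
  also have "\<dots> = (\<Sum>\<sigma> | \<sigma> permutes ?S. of_int (sign \<pi>) * (of_int (sign (\<pi> \<circ> \<sigma>)) * (\<Prod>a\<in>?S. (\<alpha>s ! a) (vs ! (\<pi> \<circ> \<sigma>) a))))"
  proof (rule sum.cong[OF refl])
    fix \<sigma> assume "\<sigma> \<in> {\<sigma>. \<sigma> permutes ?S}"
    then have "sign \<pi> * sign (\<pi> \<circ> \<sigma>) = sign \<sigma>"
      using p \<pi> by (simp add: sign_compose mult.assoc[symmetric])
    then have "real_of_int (sign \<pi>) * real_of_int (sign (\<pi> \<circ> \<sigma>)) = real_of_int (sign \<sigma>)"
      by (metis of_int_mult)
    then show "of_int (sign \<sigma>) * (\<Prod>a\<in>?S. (\<alpha>s ! a) (vs ! (\<pi> \<circ> \<sigma>) a)) =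
      of_int (sign \<pi>) * (of_int (sign (\<pi> \<circ> \<sigma>)) * (\<Prod>a\<in>?S. (\<alpha>s ! a) (vs ! (\<pi> \<circ> \<sigma>) a)))"
      by (simp add: mult.assoc[symmetric])
  qed
  also have "\<dots> = of_int (sign \<pi>) * (\<Sum>\<sigma> | \<sigma> permutes ?S. of_int (sign (\<pi> \<circ> \<sigma>)) * (\<Prod>a\<in>?S. (\<alpha>s ! a) (vs ! (\<pi> \<circ> \<sigma>) a)))"
    by (simp add: sum_distrib_left)
  also have "(\<Sum>\<sigma> | \<sigma> permutes ?S. of_int (sign (\<pi> \<circ> \<sigma>)) * (\<Prod>a\<in>?S. (\<alpha>s ! a) (vs ! (\<pi> \<circ> \<sigma>) a))) = wedge \<alpha>s vs"
    unfolding wedge_def len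
    by (rule setum_permutations_compose_left[OF \<pi>, symmetric])
  finally show ?thesis .
qed

text \<open>Swapping two equal entries changes the sign but not the list, so the value is its own
  negative.\<close>

lemma wedge_repeated:
  assumes "length \<alpha>s = length vs" "\<not> distinct vs"
  shows "wedge \<alpha>s vs = 0"
proof -
  obtain i j where ij: "i < length vs" "j < length vs" "i \<noteq> j" "vs ! i = vs ! j"
    using assms(2) by (auto simp: distinct_conv_nth)
  let ?t = "Transposition.transpose i j"
  have t: "?t permutes {..<length vs}"
    using ij by (intro permutes_swap_id) auto
  have "permute_list ?t vs = vs"
    by (rule nth_equalityI) (use ij t in \<open>auto simp: permute_list_nth Transposition.transpose_def\<close>)
  with wedge_permute[OF t assms(1)] ij show ?thesis
    by (simp add: sign_swap_id)
qed

text \<open>One pair \<open>s\<close>, \<open>J\<close> serves all functionals at once: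
  \<open>s\<close> is the sign of the sorting permutation. With a repeated index \<open>s\<close> is
  0 and \<open>J\<close> is a dummy, hence the disjunction.\<close>

lemma wedge_sorting:
  fixes K :: "'n::linorder list"
  assumes "length K = p"
  shows "\<exists>s J. (s = 0 \<or> J \<in> multi p) \<and>
    (\<forall>\<alpha>s :: ('n \<Rightarrow> real) list. length \<alpha>s = p \<longrightarrow> wedge \<alpha>s K = s * wedge \<alpha>s J)"
proof (cases "distinct K")
  case True
  obtain \<pi> where \<pi>: "\<pi> permutes {..<length (sort K)}" "permute_list \<pi> (sort K) = K"
    by (rule mset_eq_permutation[of K "sort K"]) auto
  have "sort K \<in> multi p"
    using True assms by (simp add: multi_def strict_sorted_iff)
  moreover have "wedge \<alpha>s K = of_int (sign \<pi>) * wedge \<alpha>s (sort K)" if "length \<alpha>s = p" for \<alpha>s :: "('n \<Rightarrow> real) list"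
    using wedge_permute[OF \<pi>(1), of \<alpha>s] \<pi>(2) that assms by simp
  ultimately show ?thesis by blast
next
  case False
  then have "wedge \<alpha>s K = 0 * wedge \<alpha>s K" if "length \<alpha>s = p" for \<alpha>s :: "('n \<Rightarrow> real) list"
    using wedge_repeated[of \<alpha>s K] that assms by simp
  then show ?thesis by blast
qed

text \<open>A permutation contributes only if \<open>I ! a = J ! \<sigma> a\<close> for all
  \<open>a\<close>; then the lists have the same entries, being strictly increasing they are equal,
  and distinctness leaves \<open>\<sigma> = id\<close>.\<close>

lemma wedge_multi_delta:
  assumes "I \<in> multi p" "J \<in> multi p"
  shows "wedge (map (\<lambda>i k. if i = k then 1 else 0) I) J = (if I = J then 1 else 0)"
proof -
  have len: "length I = p" "length J = p" and dist: "distinct I" "distinct J" and sorted: "sorted I" "sorted J"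
    using assms by (auto simp: multi_def strict_sorted_iff)
  have *: "(\<Prod>a<p. (map (\<lambda>i k. if i = k then 1 else 0) I ! a) (J ! \<sigma> a)) =
      (if \<forall>a<p. I ! a = J ! \<sigma> a then 1 else (0::real))" for \<sigma>
  proof (cases "\<forall>a<p. I ! a = J ! \<sigma> a")
    case False
    then obtain a where "a < p" "I ! a \<noteq> J ! \<sigma> a" by blast
    then have "\<exists>a\<in>{..<p}. (map (\<lambda>i k. if i = k then 1 else 0) I ! a) (J ! \<sigma> a) = (0::real)"
      by (intro bexI[of _ a]) (auto simp: len)
    then show ?thesis using False by (simp add: prod_zero)
  qed (simp add: len)
  have eq: "I = J \<and> \<sigma> = id" if \<sigma>: "\<sigma> permutes {..<p}" and a: "\<forall>a<p. I ! a = J ! \<sigma> a" for \<sigma>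
  proof -
    have "set I \<subseteq> set J"
    proof
      fix x assume "x \<in> set I"
      then obtain a where "a < p" "x = I ! a" using len by (auto simp: in_set_conv_nth)
      then show "x \<in> set J"
        using a permutes_in_image[OF \<sigma>, of a] len by auto
    qed
    moreover have "card (set I) = card (set J)"
      using len dist by (simp add: distinct_card)
    ultimately have "set I = set J"
      by (intro card_subset_eq) auto
    then have IJ: "I = J"
      using sorted_distinct_set_unique sorted dist by blast
    have "\<sigma> a = a" for a
    proof (cases "a < p")
      case True
      then have "J ! a = J ! \<sigma> a" using a IJ by simp
      then show ?thesis
        using nth_eq_iff_index_eq[OF dist(2)] True permutes_in_image[OF \<sigma>, of a] len by auto
    next
      case False
      then show ?thesis using \<sigma> by (simp add: permutes_not_in)
    qed
    then show ?thesis using IJ by auto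
  qed
  have "wedge (map (\<lambda>i k. if i = k then 1 else 0) I) J =
      (\<Sum>\<sigma> | \<sigma> permutes {..<p}. if \<sigma> = id then (if I = J then 1 else 0) else 0)"
    unfolding wedge_def length_map len
  proof (rule sum.cong[OF refl])
    fix \<sigma> assume "\<sigma> \<in> {\<sigma>. \<sigma> permutes {..<p}}"
    then have \<sigma>: "\<sigma> permutes {..<p}" by simp
    have "(\<forall>a<p. I ! a = J ! \<sigma> a) \<longleftrightarrow> I = J \<and> \<sigma> = id"
      using eq[OF \<sigma>] by auto
    then show "of_int (sign \<sigma>) * (\<Prod>a<p. (map (\<lambda>i k. if i = k then 1 else 0) I ! a) (J ! \<sigma> a)) =
        (if \<sigma> = id then (if I = J then 1 else 0) else (0::real))"
      unfolding * by auto
  qed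
  also have "\<dots> = (if I = J then 1 else 0)"
    by (subst sum.delta) (auto simp: finite_permutations permutes_id)
  finally show ?thesis .
qed

text \<open>Multilinear expansion over all choice functions \<open>K\<close>. The type of the
  arguments carries no vector space structure, so being a combination of the \<open>e k\<close> is
  expressed through the functionals in \<open>\<alpha>s\<close>.\<close>

lemma wedge_expand:
  fixes e :: "'k::finite \<Rightarrow> 'b"
  assumes len: "length \<alpha>s = p" "length ws = p"
    and lin: "\<And>\<alpha> b. \<alpha> \<in> set \<alpha>s \<Longrightarrow> b < p \<Longrightarrow> \<alpha> (ws ! b) = (\<Sum>k\<in>UNIV. A b k * \<alpha> (e k))"
  shows "wedge \<alpha>s ws = (\<Sum>K\<in>PiE {..<p} (\<lambda>_. UNIV). (\<Prod>b<p. A b (K b)) * wedge \<alpha>s (map (\<lambda>b. e (K b)) [0..<p]))"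
proof -
  have "wedge \<alpha>s ws = (\<Sum>\<sigma> | \<sigma> permutes {..<p}. of_int (sign \<sigma>) * (\<Prod>b<p. (\<alpha>s ! \<sigma> b) (ws ! b)))"
    using wedge_transpose[of ws \<alpha>s] len by simp
  also have "\<dots> = (\<Sum>\<sigma> | \<sigma> permutes {..<p}. of_int (sign \<sigma>) *
      (\<Sum>K\<in>PiE {..<p} (\<lambda>_. UNIV). \<Prod>b<p. A b (K b) * (\<alpha>s ! \<sigma> b) (e (K b))))"
  proof (intro sum.cong refl arg_cong2[where f="(*)"])
    fix \<sigma> assume "\<sigma> \<in> {\<sigma>. \<sigma> permutes {..<p}}"
    then have "\<sigma> b < p" if "b < p" for b
      using that permutes_in_image[of \<sigma> "{..<p}" b] by auto
    then have "(\<Prod>b<p. (\<alpha>s ! \<sigma> b) (ws ! b)) = (\<Prod>b<p. \<Sum>k\<in>UNIV. A b k * (\<alpha>s ! \<sigma> b) (e k))"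
      by (intro prod.cong refl lin) (auto simp: len)
    also have "\<dots> = (\<Sum>K\<in>PiE {..<p} (\<lambda>_. UNIV). \<Prod>b<p. A b (K b) * (\<alpha>s ! \<sigma> b) (e (K b)))"
      by (rule prod_sum_PiE) auto
    finally show "(\<Prod>b<p. (\<alpha>s ! \<sigma> b) (ws ! b)) =
      (\<Sum>K\<in>PiE {..<p} (\<lambda>_. UNIV). \<Prod>b<p. A b (K b) * (\<alpha>s ! \<sigma> b) (e (K b)))" .
  qed
  also have "\<dots> = (\<Sum>K\<in>PiE {..<p} (\<lambda>_. UNIV). \<Sum>\<sigma> | \<sigma> permutes {..<p}. of_int (sign \<sigma>) *
      (\<Prod>b<p. A b (K b) * (\<alpha>s ! \<sigma> b) (e (K b))))"
    by (simp only: sum_distrib_left) (rule sum.swap)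
  also have "\<dots> = (\<Sum>K\<in>PiE {..<p} (\<lambda>_. UNIV). (\<Prod>b<p. A b (K b)) * wedge \<alpha>s (map (\<lambda>b. e (K b)) [0..<p]))"
    by (rule sum.cong[OF refl])
       (simp add: wedge_transpose len prod.distrib sum_distrib_left mult.left_commute)
  finally show ?thesis .
qed

text \<open>Passes from the list-indexed exterior product to \<open>det\<close>, indexed by the type
  \<open>'n\<close>, so that multiplicativity of \<open>det\<close> becomes available. The bijection
  \<open>e\<close> enumerates the type in increasing order.\<close>

lemma wedge_det:
  assumes "length vs = CARD('n)"
  obtains e :: "nat \<Rightarrow> 'n::{finite,linorder}" where "bij_betw e {..<CARD('n)} UNIV"
    "\<And>\<alpha> :: 'n \<Rightarrow> 'b \<Rightarrow> real. wedge (map \<alpha> (sorted_list_of_set UNIV)) vs =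
      det (\<chi> i j. \<alpha> i (vs ! inv_into {..<CARD('n)} e j))"
proof -
  let ?S = "{..<CARD('n)}" and ?l = "sorted_list_of_set (UNIV :: 'n set)"
  define e where "e = (!) ?l"
  have len: "length ?l = CARD('n)" by simp
  have bij: "bij_betw e ?S UNIV"
    unfolding e_def by (rule bij_betw_nth) auto
  then have inj: "inj_on e ?S" and im: "e ` ?S = UNIV"
    by (auto simp: bij_betw_def)
  have "wedge (map \<alpha> ?l) vs = det (\<chi> i j. \<alpha> i (vs ! inv_into ?S e j))" for \<alpha> :: "'n \<Rightarrow> 'b \<Rightarrow> real"
  proof -
    let ?g = "map_permutation ?S e"
    have "det (\<chi> i j. \<alpha> i (vs ! inv_into ?S e j)) =
        (\<Sum>\<tau> | \<tau> permutes UNIV. of_int (sign \<tau>) * (\<Prod>i\<in>UNIV. \<alpha> i (vs ! inv_into ?S e (\<tau> i))))"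
      by (simp add: det_def)
    also have "\<dots> = (\<Sum>\<sigma> | \<sigma> permutes ?S. of_int (sign (?g \<sigma>)) * (\<Prod>i\<in>UNIV. \<alpha> i (vs ! inv_into ?S e (?g \<sigma> i))))"
    proof (rule sum.reindex_bij_betw[symmetric])
      have "?g = (\<lambda>\<pi> x. if x \<in> UNIV then e (\<pi> (inv_into ?S e x)) else x)"
        by (auto simp: fun_eq_iff map_permutation_def restrict_id_def im)
      then show "bij_betw ?g {\<sigma>. \<sigma> permutes ?S} {\<tau>. \<tau> permutes UNIV}"
        using bij_betw_permutations[OF bij] by simp
    qed
    also have "\<dots> = (\<Sum>\<sigma> | \<sigma> permutes ?S. of_int (sign \<sigma>) * (\<Prod>a\<in>?S. (map \<alpha> ?l ! a) (vs ! \<sigma> a)))"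
    proof (rule sum.cong[OF refl])
      fix \<sigma> assume "\<sigma> \<in> {\<sigma>. \<sigma> permutes ?S}"
      then have \<sigma>: "\<sigma> permutes ?S" by simp
      have "(\<Prod>i\<in>UNIV. \<alpha> i (vs ! inv_into ?S e (?g \<sigma> i))) = (\<Prod>a\<in>?S. \<alpha> (e a) (vs ! inv_into ?S e (?g \<sigma> (e a))))"
        by (rule prod.reindex_bij_betw[OF bij, symmetric])
      also have "\<dots> = (\<Prod>a\<in>?S. (map \<alpha> ?l ! a) (vs ! \<sigma> a))"
      proof (rule prod.cong[OF refl])
        fix a assume a: "a \<in> ?S"
        then have "\<sigma> a \<in> ?S" using permutes_in_image[OF \<sigma>] by blast
        then show "\<alpha> (e a) (vs ! inv_into ?S e (?g \<sigma> (e a))) = (map \<alpha> ?l ! a) (vs ! \<sigma> a)"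
          using a inj by (simp add: map_permutation_apply inv_into_f_f e_def)
      qed
      finally show "of_int (sign (?g \<sigma>)) * (\<Prod>i\<in>UNIV. \<alpha> i (vs ! inv_into ?S e (?g \<sigma> i))) =
          of_int (sign \<sigma>) * (\<Prod>a\<in>?S. (map \<alpha> ?l ! a) (vs ! \<sigma> a))"
        using sign_map_permutation[OF inj \<sigma>] by simp
    qed
    finally show ?thesis by (simp add: wedge_def)
  qed
  with bij show ?thesis by (rule that)
qed

text \<open>The derivative of a minor along \<open>M' = P M\<close> replaces its rows one at a time.\<close>

lemma wedge_has_derivative:
  fixes M :: "real \<Rightarrow> 'n::finite \<Rightarrow> 'k \<Rightarrow> real"
  assumes len: "length I = length K"
    and M: "\<And>i k. k \<in> set K \<Longrightarrow> ((\<lambda>t. M t i k) has_real_derivative (\<Sum>l\<in>UNIV. P i l * M x l k)) (at x)"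
  shows "((\<lambda>t. wedge (map (M t) I) K) has_real_derivative
    (\<Sum>h<length I. \<Sum>l\<in>UNIV. P (I ! h) l * wedge (map (M x) (I[h := l])) K)) (at x)"
proof -
  let ?p = "length I"
  have "((\<lambda>t. \<Prod>a<?p. M t (I ! a) (K ! \<sigma> a)) has_real_derivative
      (\<Sum>h<?p. \<Sum>l\<in>UNIV. P (I ! h) l * (\<Prod>a<?p. M x (I[h := l] ! a) (K ! \<sigma> a)))) (at x)"
    if \<sigma>: "\<sigma> permutes {..<?p}" for \<sigma>
  proof -
    have K: "K ! \<sigma> a \<in> set K" if "a < ?p" for a
      using permutes_in_image[OF \<sigma>, of a] that len by auto
    have "((\<lambda>t. \<Prod>a<?p. M t (I ! a) (K ! \<sigma> a)) has_real_derivative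
      (\<Sum>h<?p. (\<Sum>l\<in>UNIV. P (I ! h) l * M x l (K ! \<sigma> h)) * (\<Prod>a\<in>{..<?p} - {h}. M x (I ! a) (K ! \<sigma> a)))) (at x)"
      by (rule has_field_derivative_prod) (use M K in auto)
    also have "(\<Sum>h<?p. (\<Sum>l\<in>UNIV. P (I ! h) l * M x l (K ! \<sigma> h)) * (\<Prod>a\<in>{..<?p} - {h}. M x (I ! a) (K ! \<sigma> a))) =
      (\<Sum>h<?p. \<Sum>l\<in>UNIV. P (I ! h) l * (\<Prod>a<?p. M x (I[h := l] ! a) (K ! \<sigma> a)))"
    proof (rule sum.cong[OF refl])
      fix h assume h: "h \<in> {..<?p}"
      have "(\<Prod>a<?p. M x (I[h := l] ! a) (K ! \<sigma> a)) = M x l (K ! \<sigma> h) * (\<Prod>a\<in>{..<?p} - {h}. M x (I ! a) (K ! \<sigma> a))" for l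
        using h by (subst prod.remove[OF _ h]) (auto intro!: prod.cong)
      then show "(\<Sum>l\<in>UNIV. P (I ! h) l * M x l (K ! \<sigma> h)) * (\<Prod>a\<in>{..<?p} - {h}. M x (I ! a) (K ! \<sigma> a)) =
          (\<Sum>l\<in>UNIV. P (I ! h) l * (\<Prod>a<?p. M x (I[h := l] ! a) (K ! \<sigma> a)))"
        by (simp add: sum_distrib_right mult.assoc)
    qed
    finally show ?thesis .
  qed
  then have "((\<lambda>t. \<Sum>\<sigma> | \<sigma> permutes {..<?p}. of_int (sign \<sigma>) * (\<Prod>a<?p. M t (I ! a) (K ! \<sigma> a))) has_real_derivative
      (\<Sum>\<sigma> | \<sigma> permutes {..<?p}. of_int (sign \<sigma>) *
        (\<Sum>h<?p. \<Sum>l\<in>UNIV. P (I ! h) l * (\<Prod>a<?p. M x (I[h := l] ! a) (K ! \<sigma> a))))) (at x)"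
    by (intro DERIV_sum DERIV_cmult) auto
  also have "(\<Sum>\<sigma> | \<sigma> permutes {..<?p}. of_int (sign \<sigma>) *
        (\<Sum>h<?p. \<Sum>l\<in>UNIV. P (I ! h) l * (\<Prod>a<?p. M x (I[h := l] ! a) (K ! \<sigma> a)))) =
      (\<Sum>h<?p. \<Sum>\<sigma> | \<sigma> permutes {..<?p}. \<Sum>l\<in>UNIV. of_int (sign \<sigma>) *
         (P (I ! h) l * (\<Prod>a<?p. M x (I[h := l] ! a) (K ! \<sigma> a))))"
    by (simp only: sum_distrib_left) (rule sum.swap)
  also have "\<dots> = (\<Sum>h<?p. \<Sum>l\<in>UNIV. \<Sum>\<sigma> | \<sigma> permutes {..<?p}. of_int (sign \<sigma>) *
         (P (I ! h) l * (\<Prod>a<?p. M x (I[h := l] ! a) (K ! \<sigma> a))))"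
    by (rule sum.cong[OF refl], rule sum.swap)
  also have "\<dots> = (\<Sum>h<?p. \<Sum>l\<in>UNIV. P (I ! h) l * wedge (map (M x) (I[h := l])) K)"
    by (simp add: wedge_def sum_distrib_left mult.left_commute)
  finally show ?thesis
    by (simp add: wedge_def)
qed

section \<open>Coordinate changes and tangent vectors\<close>

lemma chart_inv_apply: "is_chart c \<Longrightarrow> m \<in> fst c \<Longrightarrow> chart_inv c (snd c m) = m"
  unfolding is_chart_def homeomorphism_def by blast

lemma chart_inv_in: "y \<in> snd c ` fst c \<Longrightarrow> chart_inv c y \<in> fst c"
  by (rule inv_into_into)

lemma apply_chart_inv: "y \<in> snd c ` fst c \<Longrightarrow> snd c (chart_inv c y) = y"
  by (rule f_inv_into_f)

lemma open_chart_image: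
  assumes "is_chart c" "open W"
  shows "open (snd c ` (fst c \<inter> W))"
proof -
  have "snd c ` (fst c \<inter> W) = snd c ` fst c \<inter> chart_inv c -` W"
    using chart_inv_apply[OF assms(1)] by force
  moreover have "open (snd c ` fst c \<inter> chart_inv c -` W)"
    using assms unfolding is_chart_def homeomorphism_def
    by (intro continuous_open_preimage) auto
  ultimately show ?thesis by simp
qed

lemma open_chart_image_sub: "is_chart c \<Longrightarrow> open W \<Longrightarrow> W \<subseteq> fst c \<Longrightarrow> open (snd c ` W)"
  using open_chart_image[of c W] by (simp add: Int_absorb1)

lemma open_chart_preimage:
  assumes "is_chart c" "open T"
  shows "open (fst c \<inter> snd c -` T)"
  using assms unfolding is_chart_def homeomorphism_def
  by (intro continuous_open_preimage) auto

text \<open>In the chart \<open>c\<close>, \<open>f\<close> is its expression in the chart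
  \<open>d\<close> after the transition from \<open>c\<close> to \<open>d\<close>.\<close>

lemma smooth_on_chart_compose:
  assumes c: "is_chart c" and d: "is_chart d" and cd: "smooth_transition c d" and W: "open W"
    and f: "smooth_on (snd d ` (fst d \<inter> W)) (\<lambda>y. f (chart_inv d y))"
  shows "smooth_on (snd c ` (fst c \<inter> (fst d \<inter> W))) (\<lambda>y. f (chart_inv c y))"
proof -
  let ?S = "snd c ` (fst c \<inter> (fst d \<inter> W))" and ?T = "snd d ` (fst d \<inter> W)"
  have "open (fst d)" using d by (simp add: is_chart_def)
  then have S: "open ?S" and T: "open ?T"
    using c d W by (auto intro!: open_chart_image)
  have "smooth_on ?S (\<lambda>y. f (chart_inv d (snd d (chart_inv c y))))"
  proof (rule smooth_on_compose[OF S T, of "\<lambda>y. snd d (chart_inv c y)" "\<lambda>y. f (chart_inv d y)"])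
    show "(\<lambda>y. snd d (chart_inv c y)) ` ?S \<subseteq> ?T"
      using chart_inv_apply[OF c] by force
    show "smooth_on ?S (\<lambda>y. snd d (chart_inv c y) $ j)" for j
      by (rule smooth_on_subset[of "snd c ` (fst c \<inter> fst d)"])
         (use cd in \<open>auto simp: smooth_transition_def\<close>)
  qed (rule f)
  moreover have "f (chart_inv d (snd d (chart_inv c y))) = f (chart_inv c y)" if "y \<in> ?S" for y
  proof -
    from that obtain m where "m \<in> fst c" "m \<in> fst d" "y = snd c m" by blast
    then show ?thesis by (simp add: chart_inv_apply c d)
  qed
  ultimately show ?thesis
    using smooth_on_cong[OF S, of "\<lambda>y. f (chart_inv d (snd d (chart_inv c y)))" "\<lambda>y. f (chart_inv c y)"] by blast
qed

context
  fixes A :: "('a::{t2_space,second_countable_topology}, 'n::finite) chart set"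
  assumes manifold: "smooth_manifold A"
begin

lemma coord_system_chart: "coord_system A c \<Longrightarrow> is_chart c"
  by (simp add: coord_system_def)

lemma atlas_coord_system: "c \<in> A \<Longrightarrow> coord_system A c"
  using manifold unfolding smooth_manifold_def coord_system_def points_def by blast

text \<open>\<open>coord_system\<close> guarantees compatibility with the charts in \<open>A\<close>
  alone; near each point the transition is therefore factored through a chart \<open>e\<close> of
  \<open>A\<close> around that point.\<close>

lemma coord_system_transition:
  assumes c: "coord_system A c" and d: "coord_system A d"
  shows "smooth_transition c d"
  unfolding smooth_transition_def
proof (intro allI smooth_on_local)
  fix i y assume "y \<in> snd c ` (fst c \<inter> fst d)"
  then obtain m where m: "m \<in> fst c" "m \<in> fst d" "y = snd c m" by blast
  then obtain e where e: "e \<in> A" "m \<in> fst e"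
    using c unfolding coord_system_def points_def by blast
  have ch: "is_chart c" "is_chart d" "is_chart e"
    using c d e(1) by (auto intro: coord_system_chart atlas_coord_system)
  then have o: "open (fst c)" "open (fst d)" "open (fst e)"
    by (auto simp: is_chart_def)
  let ?T = "snd c ` (fst c \<inter> (fst e \<inter> fst d))"
  have "smooth_transition c e" "smooth_transition e d"
    using c d e(1) by (auto simp: coord_system_def)
  then have "smooth_on ?T (\<lambda>y. snd d (chart_inv c y) $ i)"
    using smooth_on_chart_compose[OF ch(1,3) _ o(2), of "\<lambda>m. snd d m $ i"]
    by (simp add: smooth_transition_def)
  moreover have "open ?T" "y \<in> ?T"
    using m e(2) o by (auto intro!: open_chart_image ch)
  ultimately show "\<exists>T. open T \<and> y \<in> T \<and> smooth_on T (\<lambda>y. snd d (chart_inv c y) $ i)" by blast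
qed

text \<open>Every other coordinate system is reached from \<open>c\<close> by a smooth transition,
  so one chart decides.\<close>

lemma smooth_fun_onI:
  assumes c: "coord_system A c" and W: "open W" "W \<subseteq> fst c"
    and f: "smooth_on (snd c ` W) (\<lambda>y. f (chart_inv c y))"
  shows "smooth_fun_on A W f"
  unfolding smooth_fun_on_def
proof (intro allI impI)
  fix d assume d: "coord_system A d"
  have "smooth_on (snd d ` (fst d \<inter> (fst c \<inter> W))) (\<lambda>y. f (chart_inv d y))"
    using W f
    by (intro smooth_on_chart_compose coord_system_chart coord_system_transition c d)
       (auto simp: Int_absorb1)
  then show "smooth_on (snd d ` (fst d \<inter> W)) (\<lambda>y. f (chart_inv d y))"
    using W(2) by (simp add: Int_absorb1)
qed

lemma smooth_fun_on_subset: "smooth_fun_on A W f \<Longrightarrow> V \<subseteq> W \<Longrightarrow> smooth_fun_on A V f"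
  unfolding smooth_fun_on_def by (meson Int_mono image_mono order_refl smooth_on_subset)

lemma smooth_fun_onD:
  "smooth_fun_on A W f \<Longrightarrow> coord_system A c \<Longrightarrow> W \<subseteq> fst c \<Longrightarrow> smooth_on (snd c ` W) (\<lambda>y. f (chart_inv c y))"
  unfolding smooth_fun_on_def by (metis Int_absorb1)

lemma smooth_fun_on_coord:
  assumes c: "coord_system A c"
  shows "smooth_fun_on A (fst c) (\<lambda>m. snd c m $ i)"
proof (rule smooth_fun_onI[OF c])
  have "open (snd c ` fst c)" "open (fst c)"
    using coord_system_chart[OF c] by (auto simp: is_chart_def)
  then show "smooth_on (snd c ` fst c) (\<lambda>y. snd c (chart_inv c y) $ i)" "open (fst c)"
    using smooth_on_cong[OF _ _ smooth_on_coord] apply_chart_inv by (metis (no_types, lifting))+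
qed simp

lemma coord_system_open: "coord_system A c \<Longrightarrow> open (fst c)"
  using coord_system_chart by (auto simp: is_chart_def)

lemma coord_system_points: "coord_system A c \<Longrightarrow> fst c \<subseteq> points A"
  by (simp add: coord_system_def)

lemma smooth_nearI:
  assumes "smooth_fun_on A W f" "open W" "m \<in> W" "W \<subseteq> fst c" "coord_system A c"
  shows "smooth_near A m f"
  unfolding smooth_near_def using assms coord_system_points by blast

lemma smooth_nearE:
  assumes "smooth_near A m f" "coord_system A c" "m \<in> fst c" "open U" "m \<in> U"
  obtains W where "open W" "m \<in> W" "W \<subseteq> fst c \<inter> U" "smooth_fun_on A W f"
    "smooth_on (snd c ` W) (\<lambda>y. f (chart_inv c y))"
proof -
  obtain W where "open W" "m \<in> W" "smooth_fun_on A W f"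
    using assms(1) unfolding smooth_near_def by blast
  then have "open (W \<inter> (fst c \<inter> U))" "m \<in> W \<inter> (fst c \<inter> U)" "W \<inter> (fst c \<inter> U) \<subseteq> fst c \<inter> U"
      "smooth_fun_on A (W \<inter> (fst c \<inter> U)) f"
    using assms(3,5) smooth_fun_on_subset[of W f]
    by (auto intro: open_Int assms(4) coord_system_open[OF assms(2)])
  moreover from this have "smooth_on (snd c ` (W \<inter> (fst c \<inter> U))) (\<lambda>y. f (chart_inv c y))"
    by (intro smooth_fun_onD assms) auto
  ultimately show ?thesis by (rule that)
qed

lemma smooth_near_chartI:
  assumes c: "coord_system A c" and W: "open W" "W \<subseteq> fst c" "m \<in> W"
    and f: "smooth_on (snd c ` W) f'" "\<And>y. y \<in> W \<Longrightarrow> f y = f' (snd c y)"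
  shows "smooth_near A m f"
proof (rule smooth_nearI[OF smooth_fun_onI[OF c W(1,2)] W(1,3,2) c])
  show "smooth_on (snd c ` W) (\<lambda>y. f (chart_inv c y))"
  proof (rule smooth_on_cong[OF _ _ f(1)])
    show "open (snd c ` W)"
      by (rule open_chart_image_sub coord_system_chart c W)+
    show "f' z = f (chart_inv c z)" if "z \<in> snd c ` W" for z
      using that W(2) f(2) chart_inv_apply[OF coord_system_chart[OF c]] by auto
  qed
qed

section \<open>Germs of smooth functions, partial derivatives and derivations at a point\<close>

context
  fixes c m
  assumes c: "coord_system A c" and m: "m \<in> fst c"
begin

lemma smooth_near_cong:
  assumes "smooth_near A m f" "open U" "m \<in> U" "\<And>y. y \<in> U \<Longrightarrow> f y = g y"
  shows "smooth_near A m g"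
proof -
  obtain W where W: "open W" "m \<in> W" "W \<subseteq> fst c \<inter> U" "smooth_on (snd c ` W) (\<lambda>y. f (chart_inv c y))"
    by (rule smooth_nearE[OF assms(1) c m assms(2,3)])
  show ?thesis
    by (rule smooth_near_chartI[OF c W(1) _ W(2,4)])
       (use W(3) assms(4) chart_inv_apply[OF coord_system_chart[OF c]] in \<open>auto simp: subset_iff\<close>)
qed

lemma smooth_near_const: "smooth_near A m (\<lambda>_. a)"
  by (rule smooth_near_chartI[OF c coord_system_open[OF c] order_refl m smooth_on_const[of _ a]])
     (use coord_system_chart[OF c] in \<open>auto simp: is_chart_def\<close>)

lemma smooth_near_coord: "smooth_near A m (\<lambda>y. snd c y $ i)"
  by (rule smooth_nearI[OF smooth_fun_on_coord[OF c] coord_system_open[OF c] m order_refl c])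

lemma
  assumes f: "smooth_near A m f" and g: "smooth_near A m g"
  shows smooth_near_add: "smooth_near A m (\<lambda>y. f y + g y)"
    and smooth_near_mult: "smooth_near A m (\<lambda>y. f y * g y)"
proof -
  have ch: "is_chart c" by (rule coord_system_chart[OF c])
  obtain U where U: "open U" "m \<in> U" "U \<subseteq> fst c \<inter> UNIV" "smooth_on (snd c ` U) (\<lambda>y. f (chart_inv c y))"
    by (rule smooth_nearE[OF f c m open_UNIV]) auto
  obtain W where W: "open W" "m \<in> W" "W \<subseteq> fst c \<inter> U" "smooth_on (snd c ` W) (\<lambda>y. g (chart_inv c y))"
    by (rule smooth_nearE[OF g c m U(1,2)])
  have "W \<subseteq> fst c" using W by auto
  note o = open_chart_image_sub[OF ch W(1) this]
  have f': "smooth_on (snd c ` W) (\<lambda>y. f (chart_inv c y))"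
    by (rule smooth_on_subset[OF U(4)]) (use W(3) in auto)
  show "smooth_near A m (\<lambda>y. f y + g y)"
    by (rule smooth_near_chartI[OF c W(1) _ W(2) smooth_on_add[OF o f' W(4)]])
       (use W(3) chart_inv_apply[OF ch] in auto)
  show "smooth_near A m (\<lambda>y. f y * g y)"
    by (rule smooth_near_chartI[OF c W(1) _ W(2) smooth_on_mult[OF o f' W(4)]])
       (use W(3) chart_inv_apply[OF ch] in auto)
qed

lemma smooth_near_sum: "(\<And>i. i \<in> I \<Longrightarrow> smooth_near A m (f i)) \<Longrightarrow> smooth_near A m (\<lambda>y. \<Sum>i\<in>I. f i y)"
  by (induction I rule: infinite_finite_induct) (auto intro: smooth_near_const smooth_near_add)

lemma smooth_near_pd:
  assumes "smooth_near A m f"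
  shows "smooth_near A m (pd c j f)"
proof -
  obtain W where W: "open W" "m \<in> W" "W \<subseteq> fst c \<inter> UNIV" "smooth_on (snd c ` W) (\<lambda>y. f (chart_inv c y))"
    by (rule smooth_nearE[OF assms c m open_UNIV]) auto
  show ?thesis
    by (rule smooth_near_chartI[OF c W(1) _ W(2) smooth_on_partial[OF W(4)]])
       (use W(3) in \<open>auto simp: pd_def\<close>)
qed

lemma smooth_near_differentiable:
  assumes "smooth_near A m f"
  shows "(\<lambda>y. f (chart_inv c y)) differentiable (at (snd c m))"
proof -
  obtain W where W: "open W" "m \<in> W" "W \<subseteq> fst c \<inter> UNIV" "smooth_on (snd c ` W) (\<lambda>y. f (chart_inv c y))"
    by (rule smooth_nearE[OF assms c m open_UNIV]) auto
  show ?thesis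
    by (rule smooth_on_differentiable[OF W(4) open_chart_image_sub])
       (use W c in \<open>auto intro: coord_system_chart\<close>)
qed

lemma pd_cong:
  assumes "open U" "m \<in> U" "\<And>y. y \<in> U \<Longrightarrow> f y = g y"
  shows "pd c j f m = pd c j g m"
  unfolding pd_def
proof (rule partial_cong)
  show "open (snd c ` (fst c \<inter> U))"
    by (intro open_chart_image coord_system_chart c assms)
  show "f (chart_inv c z) = g (chart_inv c z)" if "z \<in> snd c ` (fst c \<inter> U)" for z
    using that assms(3) chart_inv_apply[OF coord_system_chart[OF c]] by auto
qed (use m assms in auto)

text \<open>Together with \<open>pd_eqI\<close> this reduces the sum and product rules for
  \<open>pd\<close> to one-variable calculus along a coordinate line.\<close>

lemma pd_DERIV:
  assumes "smooth_near A m f"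
  shows "((\<lambda>t. f (chart_inv c (snd c m + t *\<^sub>R axis j 1))) has_real_derivative pd c j f m) (at 0)"
  unfolding pd_def by (rule DERIV_line_partial[OF smooth_near_differentiable[OF assms]])

lemma pd_eqI:
  assumes "((\<lambda>t. f (chart_inv c (snd c m + t *\<^sub>R axis j 1))) has_real_derivative D) (at 0)"
  shows "pd c j f m = D"
  unfolding pd_def partial_def by (rule DERIV_imp_deriv[OF assms])

lemma line_at_0: "chart_inv c (snd c m + 0 *\<^sub>R v) = m"
  using chart_inv_apply[OF coord_system_chart[OF c] m] by simp

lemma pd_lincomb:
  assumes "smooth_near A m f" "smooth_near A m g"
  shows "pd c j (\<lambda>y. a * f y + b * g y) m = a * pd c j f m + b * pd c j g m"
  by (rule pd_eqI, rule DERIV_add) (intro DERIV_cmult pd_DERIV assms)+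

lemma pd_mult:
  assumes "smooth_near A m f" "smooth_near A m g"
  shows "pd c j (\<lambda>y. f y * g y) m = f m * pd c j g m + g m * pd c j f m"
  by (rule pd_eqI, rule DERIV_cong[OF DERIV_mult[OF pd_DERIV pd_DERIV]])
     (simp_all add: assms line_at_0[unfolded scaleR_zero_left add_0_right])

lemma pd_sum:
  assumes "\<And>i. i \<in> I \<Longrightarrow> smooth_near A m (f i)"
  shows "pd c j (\<lambda>y. \<Sum>i\<in>I. f i y) m = (\<Sum>i\<in>I. pd c j (f i) m)"
  by (rule pd_eqI, rule DERIV_sum) (rule pd_DERIV assms)+

lemma pd_const: "pd c j (\<lambda>_. a) m = 0"
  by (rule pd_eqI) (rule DERIV_const)

lemma pd_coord: "pd c j (\<lambda>y. snd c y $ i) m = (if i = j then 1 else 0)"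
proof -
  have "pd c j (\<lambda>y. snd c y $ i) m = partial j (\<lambda>y. y $ i) (snd c m)"
    unfolding pd_def
    by (rule partial_cong[of "snd c ` fst c"])
       (use m coord_system_chart[OF c] apply_chart_inv in \<open>auto simp: is_chart_def chart_inv_apply\<close>)
  then show ?thesis by (auto simp: partial_coord)
qed

lemma coord_vec_tangent: "coord_vec A c i m \<in> tangent A m"
proof -
  \<comment> \<open>\<open>coord_vec\<close> takes the default value 0 on functions not smooth near
    \<open>m\<close>; linearity would fail if a combination of smooth functions hit that
    default.\<close>
  have "smooth_near A m (\<lambda>y. a * f y + b * g y)" if "smooth_near A m f" "smooth_near A m g" for a b f g
    by (intro smooth_near_add smooth_near_mult smooth_near_const that)
  then show ?thesis
    by (simp add: tangent_def coord_vec_def pd_lincomb pd_mult smooth_near_mult)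
qed

lemma coord_covec_cotangent: "coord_covec A c i m \<in> cotangent A m"
proof -
  \<comment> \<open>Linear combinations stay in the tangent space, so the default value 0 of
    \<open>differential\<close> outside it does not disturb linearity.\<close>
  have "(\<lambda>f. a * X f + b * Y f) \<in> tangent A m" if "X \<in> tangent A m" "Y \<in> tangent A m" for X Y a b
    using that unfolding tangent_def by (simp add: algebra_simps)
  then show ?thesis
    by (simp add: cotangent_def coord_covec_def differential_def)
qed

lemma coord_vec_apply: "smooth_near A m f \<Longrightarrow> coord_vec A c i m f = pd c i f m"
  by (simp add: coord_vec_def)

context
  fixes X
  assumes X: "X \<in> tangent A m"
begin

lemma tangent_lincomb: "smooth_near A m f \<Longrightarrow> smooth_near A m g \<Longrightarrow> X (\<lambda>y. a * f y + b * g y) = a * X f + b * X g"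
  using X unfolding tangent_def by blast

lemma tangent_mult: "smooth_near A m f \<Longrightarrow> smooth_near A m g \<Longrightarrow> X (\<lambda>y. f y * g y) = f m * X g + g m * X f"
  using X unfolding tangent_def by blast

lemma tangent_add: "smooth_near A m f \<Longrightarrow> smooth_near A m g \<Longrightarrow> X (\<lambda>y. f y + g y) = X f + X g"
  using tangent_lincomb[of f g 1 1] by simp

text \<open>The Leibniz rule for the product of 1 with itself makes the value at 1 equal to its
  double; other constants follow by linearity.\<close>

lemma tangent_const: "X (\<lambda>_. a) = 0"
proof -
  have "X (\<lambda>_. 1) = 0"
    using tangent_mult[OF smooth_near_const[of 1] smooth_near_const[of 1]] by simp
  then show ?thesis
    using tangent_lincomb[OF smooth_near_const[of 1] smooth_near_const[of 1], of a 0] by simp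
qed

lemma tangent_sum:
  "finite I \<Longrightarrow> (\<And>i. i \<in> I \<Longrightarrow> smooth_near A m (f i)) \<Longrightarrow> X (\<lambda>y. \<Sum>i\<in>I. f i y) = (\<Sum>i\<in>I. X (f i))"
  by (induction I rule: finite_induct) (auto simp: tangent_const tangent_add smooth_near_sum)

text \<open>If \<open>h\<close> vanishes on \<open>U\<close>, it equals its product with the indicator of the complement of \<open>U\<close>,
  and both factors vanish at \<open>m\<close>; no bump functions are needed.\<close>

lemma tangent_local:
  assumes f: "smooth_near A m f" and U: "open U" "m \<in> U" "\<And>y. y \<in> U \<Longrightarrow> f y = g y"
  shows "X f = X g"
proof -
  have g: "smooth_near A m g" by (rule smooth_near_cong[OF f U])
  define ind where "ind y = (if y \<in> U then 0 else (1::real))" for y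
  define h where "h y = 1 * f y + (-1) * g y" for y
  have ind: "smooth_near A m ind"
    by (rule smooth_near_cong[OF smooth_near_const[of 0] U(1,2)]) (simp add: ind_def)
  have h: "smooth_near A m h"
    by (rule smooth_near_cong[OF smooth_near_const[of 0] U(1,2)]) (simp add: h_def U(3))
  have "h = (\<lambda>y. ind y * h y)"
    by (auto simp: fun_eq_iff ind_def h_def U(3))
  then have "X h = X (\<lambda>y. ind y * h y)" by simp
  also have "\<dots> = 0"
    using tangent_mult[OF ind h] U by (simp add: ind_def h_def)
  finally show ?thesis
    using tangent_lincomb[OF f g, of 1 "-1"] by (simp add: h_def[abs_def])
qed

text \<open>Near \<open>m\<close>, Hadamard's lemma writes \<open>f\<close> as \<open>f m\<close>
  plus the sum of the products \<open>D i y * G i y\<close>, where \<open>D i\<close> vanishes at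
  \<open>m\<close> and \<open>G i m\<close> is the partial derivative. A derivation kills the
  constant, and the Leibniz rule keeps only \<open>G i m * X (D i)\<close>.\<close>

lemma tangent_expand:
  assumes f: "smooth_near A m f"
  shows "X f = (\<Sum>i\<in>UNIV. pd c i f m * X (\<lambda>y. snd c y $ i))"
proof -
  have ch: "is_chart c" by (rule coord_system_chart[OF c])
  obtain W where W: "open W" "m \<in> W" "W \<subseteq> fst c \<inter> UNIV" "smooth_on (snd c ` W) (\<lambda>y. f (chart_inv c y))"
    by (rule smooth_nearE[OF f c m open_UNIV]) auto
  define a where "a = snd c m"
  define f' where "f' y = f (chart_inv c y)" for y
  have oW: "open (snd c ` W)"
    by (rule open_chart_image_sub[OF ch W(1)]) (use W(3) in auto)
  \<comment> \<open>Hadamard's lemma needs a convex domain: a ball in the chart, with preimage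
    \<open>U\<close>.\<close>
  then obtain r where r: "r > 0" "ball a r \<subseteq> snd c ` W"
    using W(2) open_contains_ball a_def by blast
  have f': "smooth_on (ball a r) f'"
    using smooth_on_subset[OF W(4) r(2)] by (simp add: f'_def[abs_def])
  define U where "U = fst c \<inter> snd c -` ball a r"
  have U: "open U" "m \<in> U" "U \<subseteq> fst c"
    using open_chart_preimage[OF ch, of "ball a r"] r(1) m by (auto simp: U_def a_def)
  define G where "G i y = cone_integral a 0 (partial i f') (snd c y)" for i y
  have ball: "open (ball a r)" "convex (ball a r)" "a \<in> ball a r" using r by auto
  have G: "smooth_near A m (G i)" for i
  proof (rule smooth_near_chartI[OF c U(1,3,2)])
    show "smooth_on (snd c ` U) (cone_integral a 0 (partial i f'))"
      by (rule smooth_on_subset[OF smooth_on_cone_integral[OF ball smooth_on_partial[OF f']]])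
         (auto simp: U_def)
  qed (simp add: G_def)
  have Gm: "G i m = pd c i f m" for i
    by (simp add: G_def a_def[symmetric] cone_integral_center) (simp add: pd_def f'_def[abs_def] a_def)
  define D where "D i y = snd c y $ i + (- (a $ i))" for i y
  have x: "smooth_near A m (D i)" for i
    unfolding D_def by (intro smooth_near_add smooth_near_coord smooth_near_const)
  have t: "smooth_near A m (\<lambda>y. D i y * G i y)" for i
    by (rule smooth_near_mult[OF x G])
  have "X f = X (\<lambda>y. f m + (\<Sum>i\<in>UNIV. D i y * G i y))"
  proof (rule tangent_local[OF f U(1,2)])
    fix y assume y: "y \<in> U"
    then have "snd c y \<in> ball a r" "y \<in> fst c" by (auto simp: U_def)
    then show "f y = f m + (\<Sum>i\<in>UNIV. D i y * G i y)"
      using hadamard[OF ball f', of "snd c y"] chart_inv_apply[OF ch, of y] chart_inv_apply[OF ch m]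
      by (simp add: f'_def G_def D_def a_def)
  qed
  also have "\<dots> = (\<Sum>i\<in>UNIV. X (\<lambda>y. D i y * G i y))"
    by (simp add: tangent_add smooth_near_const smooth_near_sum t tangent_const tangent_sum)
  also have "\<dots> = (\<Sum>i\<in>UNIV. pd c i f m * X (\<lambda>y. snd c y $ i))"
  proof (rule sum.cong[OF refl])
    fix i
    have "X (D i) = X (\<lambda>y. snd c y $ i)"
      unfolding D_def by (subst tangent_add[OF smooth_near_coord smooth_near_const]) (simp add: tangent_const)
    then show "X (\<lambda>y. D i y * G i y) = pd c i f m * X (\<lambda>y. snd c y $ i)"
      by (subst tangent_mult[OF x G]) (simp add: Gm D_def a_def)
  qed
  finally show ?thesis .
qed

end

end

text \<open>The coordinate vectors of \<open>c\<close> are derivations, and their expansion in the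
  chart \<open>d\<close> already is the chain rule.\<close>

lemma pd_chain:
  assumes c: "coord_system A c" "m \<in> fst c" and d: "coord_system A d" "m \<in> fst d" and f: "smooth_near A m f"
  shows "pd c j f m = (\<Sum>k\<in>UNIV. pd d k f m * pd c j (\<lambda>y. snd d y $ k) m)"
  using tangent_expand[OF d coord_vec_tangent[OF c, of j] f]
  by (simp add: coord_vec_apply[OF c] f smooth_near_coord[OF d])

lemma wedge_dx_components:
  assumes "length Xs = length I" "set Xs \<subseteq> tangent A m"
  shows "wedge_dx A c I m Xs = wedge (map (\<lambda>i v. v i) I) (map (\<lambda>X i. X (\<lambda>y. snd c y $ i)) Xs)"
proof -
  have "wedge_dx A c I m Xs = wedge (map (\<lambda>i X. X (\<lambda>y. snd c y $ i)) I) Xs"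
    unfolding wedge_dx_def
    by (rule wedge_cong) (use assms in \<open>auto simp: coord_covec_def differential_def\<close>)
  also have "\<dots> = wedge (map (\<lambda>i v. v i) I) (map (\<lambda>X i. X (\<lambda>y. snd c y $ i)) Xs)"
    using assms(1) wedge_map_map[of I Xs "\<lambda>i v. v i" "\<lambda>X i. X (\<lambda>y. snd c y $ i)"] by simp
  finally show ?thesis .
qed

end

lemma wedge_vec_components:
  assumes "length \<alpha>s = length I"
  shows "wedge_vec A c I m \<alpha>s = wedge (map (\<lambda>i v. v i) I) (map (\<lambda>\<alpha> i. \<alpha> (coord_vec A c i m)) \<alpha>s)"
  unfolding wedge_vec_def using assms
  by (simp add: wedge_map_map[of I \<alpha>s "\<lambda>i v. v i"])

section \<open>The coefficients in a second coordinate system\<close>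

lemma finite_multi [simp]: "finite (multi p :: 'n::{finite,linorder} list set)"
  by (rule finite_subset[OF _ finite_lists_length_eq[of UNIV p]]) (auto simp: multi_def)

lemma length_multi: "I \<in> multi p \<Longrightarrow> length I = p"
  by (simp add: multi_def)

text \<open>With \<open>F'\<close> the \<open>j\<close>-th partial derivatives of the coefficients \<open>F\<close> and \<open>P i l = - \<Gamma>\<^sub>j\<^sub>l\<^sup>i\<close> this is
  \<open>\<Sum>\<^sub>J (\<partial>F\<^sub>J/\<partial>x\<^sup>j - \<Phi>\<^sub>j\<^sub>,\<^sub>J) dx\<^sup>J\<close> evaluated at vectors given by their components; with
  \<open>P i l = \<Gamma>\<^sub>j\<^sub>i\<^sup>l\<close> it is the analogous expression for multivectors.\<close>

definition variation :: "nat \<Rightarrow> ('n::{finite,linorder} list \<Rightarrow> real) \<Rightarrow> ('n list \<Rightarrow> real) \<Rightarrow> ('n \<Rightarrow> 'n \<Rightarrow> real)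
    \<Rightarrow> ('n \<Rightarrow> real) list \<Rightarrow> real" where
  "variation p F F' P \<xi>s =
    (\<Sum>J\<in>multi p. F' J * wedge (map (\<lambda>i v. v i) J) \<xi>s) +
    (\<Sum>I\<in>multi p. \<Sum>h<p. \<Sum>l\<in>UNIV. P (I ! h) l * F I * wedge (map (\<lambda>i v. v i) (I[h := l])) \<xi>s)"

text \<open>The product rule for coefficient times minor, with the derivative of the minor from
  \<open>wedge_has_derivative\<close>; \<open>M t\<close> stands for a coordinate-change matrix
  along a coordinate line.\<close>

lemma variation_DERIV:
  fixes M :: "real \<Rightarrow> 'n::{finite,linorder} \<Rightarrow> 'k \<Rightarrow> real"
  assumes len: "length K = p"
    and F: "\<And>I. I \<in> multi p \<Longrightarrow> (F I has_real_derivative F' I) (at 0)"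
    and M: "\<And>i k. ((\<lambda>t. M t i k) has_real_derivative (\<Sum>l\<in>UNIV. P i l * M 0 l k)) (at 0)"
  shows "((\<lambda>t. \<Sum>I\<in>multi p. F I t * wedge (map (M t) I) K) has_real_derivative
    variation p (\<lambda>I. F I 0) F' P (map (\<lambda>k i. M 0 i k) K)) (at 0)"
proof -
  have w: "wedge (map (\<lambda>i v. v i) J) (map (\<lambda>k i. M 0 i k) K) = wedge (map (M 0) J) K" if "length J = p" for J
    using wedge_map_map[of J K "\<lambda>i v. v i" "\<lambda>k i. M 0 i k"] that len by simp
  have "((\<lambda>t. \<Sum>I\<in>multi p. F I t * wedge (map (M t) I) K) has_real_derivative
      (\<Sum>I\<in>multi p. F' I * wedge (map (M 0) I) K +
        (\<Sum>h<length I. \<Sum>l\<in>UNIV. P (I ! h) l * wedge (map (M 0) (I[h := l])) K) * F I 0)) (at 0)"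
    by (intro DERIV_sum DERIV_mult F wedge_has_derivative M) (simp_all add: len length_multi)
  also have "(\<Sum>I\<in>multi p. F' I * wedge (map (M 0) I) K +
        (\<Sum>h<length I. \<Sum>l\<in>UNIV. P (I ! h) l * wedge (map (M 0) (I[h := l])) K) * F I 0) =
      variation p (\<lambda>I. F I 0) F' P (map (\<lambda>k i. M 0 i k) K)"
    unfolding variation_def
    by (simp add: sum.distrib[symmetric] sum_distrib_right sum_distrib_left w length_multi ac_simps)
  finally show ?thesis .
qed

text \<open>Carries an expansion with coefficients \<open>c K\<close> outward through one of the
  nested sums in \<open>variation\<close>.\<close>

lemma sum_expand:
  assumes "\<And>i. i \<in> I \<Longrightarrow> t i = (\<Sum>K\<in>S. c K * u i K :: real)"
  shows "(\<Sum>i\<in>I. t i) = (\<Sum>K\<in>S. c K * (\<Sum>i\<in>I. u i K))"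
proof -
  have "(\<Sum>i\<in>I. t i) = (\<Sum>i\<in>I. \<Sum>K\<in>S. c K * u i K)"
    by (rule sum.cong[OF refl assms])
  then show ?thesis
    by (subst (asm) sum.swap) (simp add: sum_distrib_left)
qed

text \<open>The columns of \<open>M\<close> form a basis, because \<open>N\<close> is a right inverse of \<open>M\<close>.\<close>

lemma variation_eq_0:
  fixes M N :: "'n::{finite,linorder} \<Rightarrow> 'n \<Rightarrow> real"
  assumes MN: "\<And>i j. (\<Sum>k\<in>UNIV. M i k * N k j) = (if i = j then 1 else 0)"
    and zero: "\<And>K. K \<in> multi p \<Longrightarrow> variation p F F' P (map (\<lambda>k i. M i k) K) = 0"
    and len: "length \<xi>s = p"
  shows "variation p F F' P \<xi>s = 0"
proof -
  define e where "e k i = M i k" for k i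
  \<comment> \<open>Expanding the arguments in the basis produces arbitrary index lists; sorting
    turns each into a multiple of an increasing one, or into 0.\<close>
  have zero': "variation p F F' P (map e K) = 0" if K: "length K = p" for K
  proof -
    obtain s J where J: "s = 0 \<or> J \<in> multi p"
      and s: "\<And>\<alpha>s :: ('n \<Rightarrow> real) list. length \<alpha>s = p \<Longrightarrow> wedge \<alpha>s K = s * wedge \<alpha>s J"
      using wedge_sorting[OF K] by blast
    show ?thesis
    proof (cases "s = 0")
      case True
      have "wedge (map (\<lambda>i v. v i) L) (map e K) = 0" if "length L = p" for L :: "'n list"
        using s[of "map (\<lambda>i k. e k i) L"] True wedge_map_map[of L K "\<lambda>i v. v i" e] that K by simp
      then show ?thesis by (simp add: variation_def length_multi)
    next
      case False
      then have "J \<in> multi p" using J by blast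
      have "wedge (map (\<lambda>i v. v i) L) (map e K) = s * wedge (map (\<lambda>i v. v i) L) (map e J)"
        if "length L = p" for L :: "'n list"
        using s[of "map (\<lambda>i k. e k i) L"] wedge_map_map[of L K "\<lambda>i v. v i" e]
          wedge_map_map[of L J "\<lambda>i v. v i" e] that K length_multi[OF \<open>J \<in> multi p\<close>] by simp
      then have "variation p F F' P (map e K) = s * variation p F F' P (map e J)"
        by (simp add: variation_def length_multi sum_distrib_left distrib_left mult.left_commute)
      then show ?thesis
        using zero[OF \<open>J \<in> multi p\<close>] by (simp add: e_def[abs_def])
    qed
  qed
  \<comment> \<open>Since \<open>N\<close> inverts \<open>M\<close>, these are the coordinates of
    \<open>\<xi>s ! b\<close> in the basis \<open>e\<close>.\<close>
  define A where "A b k = (\<Sum>j\<in>UNIV. N k j * (\<xi>s ! b) j)" for b k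
  define c where "c K = (\<Prod>b<p. A b (K b))" for K
  \<comment> \<open>\<open>E T\<close> is the multilinear expansion of \<open>T\<close> in that
    basis. The condition is linear in \<open>T\<close>, so it passes from exterior products to
    \<open>variation\<close>.\<close>
  define E where "E T \<longleftrightarrow> T \<xi>s = (\<Sum>K\<in>PiE {..<p} (\<lambda>_. UNIV). c K * T (map e (map K [0..<p])))" for T
  have E_wedge: "E (wedge (map (\<lambda>i v. v i) L))" if "length L = p" for L
    unfolding E_def c_def map_map o_def
  proof (rule wedge_expand)
    fix \<alpha> :: "('n \<Rightarrow> real) \<Rightarrow> real" and b assume "\<alpha> \<in> set (map (\<lambda>i v. v i) L)" "b < p"
    then obtain i where i: "\<alpha> = (\<lambda>v. v i)" by auto
    have "(\<Sum>k\<in>UNIV. A b k * e k i) = (\<Sum>k\<in>UNIV. \<Sum>j\<in>UNIV. M i k * N k j * (\<xi>s ! b) j)"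
      by (simp add: A_def e_def sum_distrib_right sum_distrib_left ac_simps)
    also have "\<dots> = (\<Sum>j\<in>UNIV. (\<Sum>k\<in>UNIV. M i k * N k j) * (\<xi>s ! b) j)"
      by (subst sum.swap) (simp add: sum_distrib_right)
    finally show "\<alpha> (\<xi>s ! b) = (\<Sum>k\<in>UNIV. A b k * \<alpha> (e k))"
      by (simp add: MN i if_distrib[where f="\<lambda>x. x * _"] cong: if_cong)
  qed (use that len in auto)
  let ?S = "PiE {..<p} (\<lambda>_. UNIV :: 'n set)"
  have mult: "a * t = (\<Sum>K\<in>?S. c K * (a * u K))" if "t = (\<Sum>K\<in>?S. c K * u K)" for a t u
    using that by (simp add: sum_distrib_left mult.left_commute)
  have E_variation: "E (variation p F F' P)"
    unfolding E_def variation_def distrib_left sum.distrib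
    by (intro arg_cong2[where f="(+)"] sum_expand mult)
       (auto intro: E_wedge[unfolded E_def] simp: length_multi simp del: map_map)
  then show ?thesis
    unfolding E_def by (simp add: zero' del: map_map)
qed


lemma form_eq_at_iff_diff: "form_eq_at A p m \<eta> \<theta> \<longleftrightarrow>
    (\<forall>Xs. length Xs = p \<and> set Xs \<subseteq> tangent A m \<longrightarrow> \<eta> Xs - \<theta> Xs = 0)"
  by (simp add: form_eq_at_def)

section \<open>Jacobian matrices of coordinate changes and the coefficients Gamma\<close>

context
  fixes A :: "('a::{t2_space,second_countable_topology}, 'n::{finite,linorder}) chart set"
    and c d :: "('a, 'n) chart"
  assumes manifold: "smooth_manifold A"
    and c: "coord_system A c" and d: "coord_system A d"
begin

text \<open>\<open>pd_chain\<close> for the coordinate functions of \<open>c\<close>, whose partial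
  derivatives in \<open>c\<close> are Kronecker deltas.\<close>

lemma coord_change_inverse:
  assumes "m \<in> fst c" "m \<in> fst d"
  shows "(\<Sum>k\<in>UNIV. pd d k (\<lambda>y. snd c y $ i) m * pd c j (\<lambda>y. snd d y $ k) m) = (if i = j then 1 else 0)"
  using pd_chain[OF manifold c assms(1) d assms(2) smooth_near_coord[OF manifold c assms(1)], of j i]
    pd_coord[OF manifold c assms(1), of j i]
  by simp

end

context
  fixes A :: "('a::{t2_space,second_countable_topology}, 'n::{finite,linorder}) chart set"
    and c d :: "('a, 'n) chart" and u :: "('a, 'n) fun_system" and m :: 'a
  assumes manifold: "smooth_manifold A"
    and c: "coord_system A c" and d: "coord_system A d"
    and m: "m \<in> fst c" "m \<in> fst d"
    and u: "\<And>j h. pd c j (\<lambda>y. u y $ h) = pd c j (\<lambda>y. snd d y $ h)"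
begin

text \<open>\<open>Gam\<close> sees \<open>u\<close> only through its partial derivatives in
  \<open>c\<close>, which are those of the chart \<open>d\<close>. Their equality as functions
  identifies the second derivatives as well, and the inverse Jacobian matrix comes from the reverse
  coordinate change.\<close>

lemma Gam_eq: "Gam c u j i b m =
    (\<Sum>h\<in>UNIV. pd d h (\<lambda>y. snd c y $ b) m * pd c j (pd c i (\<lambda>y. snd d y $ h)) m)"
proof -
  have "jacobian c u m ** (\<chi> i j. pd d j (\<lambda>y. snd c y $ i) m) = mat 1"
    using coord_change_inverse[OF manifold d c m(2,1)]
    by (simp add: vec_eq_iff jacobian_def matrix_matrix_mult_def mat_def u)
  then have "matrix_inv (jacobian c u m) = (\<chi> i j. pd d j (\<lambda>y. snd c y $ i) m)"
    by (rule matrix_inv_eq)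
  then show ?thesis by (simp add: Gam_def u)
qed

lemma smooth_near_jac: "smooth_near A m (pd c i (\<lambda>y. snd d y $ k))"
  by (rule smooth_near_pd[OF manifold c m(1) smooth_near_coord[OF manifold d m(2)]])

lemma smooth_near_inv_jac: "smooth_near A m (pd d k (\<lambda>y. snd c y $ i))"
  by (rule smooth_near_pd[OF manifold d m(2) smooth_near_coord[OF manifold c m(1)]])

text \<open>The definition of \<open>Gam\<close> solved for the second derivatives: multiplying by
  the Jacobian matrix cancels its inverse.\<close>

lemma pd_jac:
  "pd c j (pd c i (\<lambda>y. snd d y $ k)) m = (\<Sum>b\<in>UNIV. Gam c u j i b m * pd c b (\<lambda>y. snd d y $ k) m)"
proof -
  have "(\<Sum>b\<in>UNIV. Gam c u j i b m * pd c b (\<lambda>y. snd d y $ k) m) =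
      (\<Sum>b\<in>UNIV. \<Sum>h\<in>UNIV. pd c b (\<lambda>y. snd d y $ k) m * pd d h (\<lambda>y. snd c y $ b) m * pd c j (pd c i (\<lambda>y. snd d y $ h)) m)"
    by (simp add: Gam_eq sum_distrib_left ac_simps)
  also have "\<dots> = (\<Sum>h\<in>UNIV. (\<Sum>b\<in>UNIV. pd c b (\<lambda>y. snd d y $ k) m * pd d h (\<lambda>y. snd c y $ b) m) * pd c j (pd c i (\<lambda>y. snd d y $ h)) m)"
    by (subst sum.swap) (simp add: sum_distrib_right)
  finally show ?thesis
    by (simp add: coord_change_inverse[OF manifold d c m(2,1)] if_distrib[where f="\<lambda>x. x * _"] cong: if_cong)
qed

text \<open>Differentiate \<open>\<Sum>\<^sub>k B\<^sup>i\<^sub>k A\<^sup>k\<^sub>l = \<delta>\<^sup>i\<^sub>l\<close>, where \<open>A\<close> is the Jacobian matrix of \<open>d\<close> with respect to \<open>c\<close>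
  and \<open>B\<close> its inverse.\<close>

lemma pd_inv_jac:
  "pd c j (pd d k (\<lambda>y. snd c y $ i)) m = (\<Sum>l\<in>UNIV. - Gam c u j l i m * pd d k (\<lambda>y. snd c y $ l) m)"
proof -
  let ?A = "\<lambda>k i. pd c i (\<lambda>y. snd d y $ k)" and ?B = "\<lambda>i k. pd d k (\<lambda>y. snd c y $ i)"
  \<comment> \<open>The product rule gives \<open>dB A = - B dA\<close>, and the entries of
    \<open>B dA\<close> are those of \<open>Gam\<close>; multiplying by \<open>B\<close> on the
    right will isolate \<open>dB\<close>.\<close>
  have 1: "(\<Sum>h\<in>UNIV. pd c j (?B i h) m * ?A h l m) = - Gam c u j l i m" for l
  proof -
    have "0 = pd c j (\<lambda>_. if i = l then 1 else 0) m"
      by (rule pd_const[OF manifold c m(1), symmetric])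
    also have "\<dots> = pd c j (\<lambda>y. \<Sum>h\<in>UNIV. ?B i h y * ?A h l y) m"
    proof (rule pd_cong[OF manifold c m(1)])
      show "open (fst c \<inter> fst d)"
        using coord_system_open[OF manifold] c d by blast
      show "(if i = l then 1 else 0) = (\<Sum>h\<in>UNIV. ?B i h y * ?A h l y)" if "y \<in> fst c \<inter> fst d" for y
        using coord_change_inverse[OF manifold c d, of y i l] that by auto
    qed (use m in auto)
    also have "\<dots> = (\<Sum>h\<in>UNIV. pd c j (\<lambda>y. ?B i h y * ?A h l y) m)"
      by (intro pd_sum[OF manifold c m(1)] smooth_near_mult[OF manifold c m(1)] smooth_near_jac smooth_near_inv_jac)
    also have "\<dots> = (\<Sum>h\<in>UNIV. ?B i h m * pd c j (?A h l) m + ?A h l m * pd c j (?B i h) m)"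
      by (intro sum.cong refl pd_mult[OF manifold c m(1)] smooth_near_jac smooth_near_inv_jac)
    finally show ?thesis
      by (simp add: Gam_eq sum.distrib ac_simps)
  qed
  have "(\<Sum>l\<in>UNIV. - Gam c u j l i m * ?B l k m) = (\<Sum>l\<in>UNIV. \<Sum>h\<in>UNIV. pd c j (?B i h) m * (?A h l m * ?B l k m))"
    by (simp add: 1[symmetric] sum_distrib_right mult.assoc del: mult_minus_left)
  also have "\<dots> = (\<Sum>h\<in>UNIV. pd c j (?B i h) m * (\<Sum>l\<in>UNIV. ?A h l m * ?B l k m))"
    by (subst sum.swap) (simp add: sum_distrib_left)
  also have "\<dots> = pd c j (?B i k) m"
    by (simp add: coord_change_inverse[OF manifold d c m(2,1)] if_distrib[where f="\<lambda>x. _ * x"] cong: if_cong)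
  finally show ?thesis ..
qed

lemma pd_coeff:
  assumes len: "length K = p"
    and F: "\<And>I. I \<in> multi p \<Longrightarrow> smooth_near A m (F I)"
    and M: "\<And>i k. smooth_near A m (M i k)"
    and M': "\<And>i k. pd c j (M i k) m = (\<Sum>l\<in>UNIV. P i l * M l k m)"
  shows "pd c j (\<lambda>y. \<Sum>I\<in>multi p. F I y * wedge (map (\<lambda>i k. M i k y) I) K) m =
    variation p (\<lambda>I. F I m) (\<lambda>I. pd c j (F I) m) P (map (\<lambda>k i. M i k m) K)"
proof (rule pd_eqI[OF manifold c m(1)])
  define \<gamma> where "\<gamma> t = chart_inv c (snd c m + t *\<^sub>R axis j 1)" for t :: real
  have \<gamma>0: "\<gamma> 0 = m"
    unfolding \<gamma>_def by (rule line_at_0[OF manifold c m(1)])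
  have D: "((\<lambda>t. f (\<gamma> t)) has_real_derivative pd c j f m) (at 0)" if "smooth_near A m f" for f
    unfolding \<gamma>_def by (rule pd_DERIV[OF manifold c m(1) that])
  have "((\<lambda>t. \<Sum>I\<in>multi p. F I (\<gamma> t) * wedge (map (\<lambda>i k. M i k (\<gamma> t)) I) K) has_real_derivative
      variation p (\<lambda>I. F I (\<gamma> 0)) (\<lambda>I. pd c j (F I) m) P (map (\<lambda>k i. M i k (\<gamma> 0)) K)) (at 0)"
  proof (rule variation_DERIV[OF len, where M="\<lambda>t i k. M i k (\<gamma> t)" and F="\<lambda>I t. F I (\<gamma> t)"])
    show "((\<lambda>t. M i k (\<gamma> t)) has_real_derivative (\<Sum>l\<in>UNIV. P i l * M l k (\<gamma> 0))) (at 0)" for i k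
      using D[OF M[of i k]] by (simp add: M' \<gamma>0)
  qed (rule D[OF F])
  then show "((\<lambda>t. \<Sum>I\<in>multi p. F I (chart_inv c (snd c m + t *\<^sub>R axis j 1)) *
      wedge (map (\<lambda>i k. M i k (chart_inv c (snd c m + t *\<^sub>R axis j 1))) I) K) has_real_derivative
      variation p (\<lambda>I. F I m) (\<lambda>I. pd c j (F I) m) P (map (\<lambda>k i. M i k m) K)) (at 0)"
    unfolding \<gamma>0 unfolding \<gamma>_def .
qed

end

section \<open>The system for differential forms\<close>

context
  fixes A :: "('a::{t2_space,second_countable_topology}, 'n::{finite,linorder}) chart set"
    and c :: "('a, 'n) chart" and p :: nat and \<omega> :: "'a \<Rightarrow> 'a tvec list \<Rightarrow> real" and F :: "'n list \<Rightarrow> 'a \<Rightarrow> real"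
  assumes manifold: "smooth_manifold A"
    and c: "coord_system A c"
    and form: "diff_form A p \<omega>"
      "\<forall>m\<in>fst c. form_eq_at A p m (\<omega> m) (\<lambda>Xs. \<Sum>I\<in>multi p. F I m * wedge_dx A c I m Xs)"
begin

text \<open>The expansion of \<open>\<omega>\<close> is evaluated on the coordinate vectors of
  \<open>d\<close>, whose components in \<open>c\<close> are the entries of the inverse Jacobian
  matrix.\<close>

lemma form_coeff_eq:
  assumes d: "coord_system A d" and m: "m \<in> fst c" "m \<in> fst d" and K: "length K = p"
  shows "form_coeff A d \<omega> K m =
    (\<Sum>I\<in>multi p. F I m * wedge (map (\<lambda>i k. pd d k (\<lambda>y. snd c y $ i) m) I) K)"
proof -
  let ?Xs = "map (\<lambda>i. coord_vec A d i m) K"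
  have t: "set ?Xs \<subseteq> tangent A m"
    using coord_vec_tangent[OF manifold d m(2)] by auto
  have "form_coeff A d \<omega> K m = (\<Sum>I\<in>multi p. F I m * wedge_dx A c I m ?Xs)"
    using form(2) m(1) t K unfolding form_eq_at_def form_coeff_def by simp
  also have "\<dots> = (\<Sum>I\<in>multi p. F I m * wedge (map (\<lambda>i k. pd d k (\<lambda>y. snd c y $ i) m) I) K)"
  proof (intro sum.cong refl arg_cong2[where f="(*)"])
    fix I :: "'n list" assume "I \<in> multi p"
    then have I: "length I = length K" using K by (simp add: length_multi)
    have "wedge_dx A c I m ?Xs = wedge (map (\<lambda>i v. v i) I) (map (\<lambda>k i. pd d k (\<lambda>y. snd c y $ i) m) K)"
      by (subst wedge_dx_components[OF manifold])
         (use I t in \<open>simp_all add: o_def coord_vec_apply[OF manifold d m(2)] smooth_near_coord[OF manifold c m(1)]\<close>)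
    then show "wedge_dx A c I m ?Xs = wedge (map (\<lambda>i k. pd d k (\<lambda>y. snd c y $ i) m) I) K"
      using wedge_map_map[OF I, of "\<lambda>i v. v i" "\<lambda>k i. pd d k (\<lambda>y. snd c y $ i) m"] by simp
  qed
  finally show ?thesis .
qed

text \<open>The hypotheses speak of smoothness of \<open>form_coeff\<close>, not of
  \<open>F\<close>. For \<open>d = c\<close> the minors in \<open>form_coeff_eq\<close> are
  Kronecker deltas, so the two agree on the domain of \<open>c\<close>.\<close>

lemma smooth_near_form_component:
  assumes m: "m \<in> fst c" and J: "J \<in> multi p"
  shows "smooth_near A m (F J)"
proof (rule smooth_near_cong[OF manifold c m])
  show "smooth_near A m (form_coeff A c \<omega> J)"
    using form(1) c J m coord_system_open[OF manifold c]
    unfolding diff_form_def by (intro smooth_nearI[OF manifold, where W="fst c" and c=c]) blast+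
  show "form_coeff A c \<omega> J y = F J y" if y: "y \<in> fst c" for y
  proof -
    have "form_coeff A c \<omega> J y = (\<Sum>I\<in>multi p. F I y * (if I = J then 1 else 0))"
      unfolding form_coeff_eq[OF c y y length_multi[OF J]]
      by (intro sum.cong refl arg_cong2[where f="(*)"])
         (simp add: pd_coord[OF manifold c y] wedge_multi_delta J)
    then show ?thesis using J by (simp add: if_distrib[where f="\<lambda>x. _ * x"] cong: if_cong)
  qed
qed (use m coord_system_open[OF manifold c] in auto)

text \<open>For increasing \<open>J\<close>, a solution forces \<open>\<Phi>\<close> to agree on
  \<open>W\<close> with the derivatives of \<open>F\<close>; substituting these turns the system
  into the identity that defines \<open>\<Phi>\<close>.\<close>

lemma solves_form_system_iff_Phi:
  "solves_form_system A c p F W u \<longleftrightarrow> is_Phi_form A c p F W u (\<lambda>j J. pd c j (F J))"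
proof
  assume "solves_form_system A c p F W u"
  then obtain \<Phi> where "is_Phi_form A c p F W u \<Phi>" and eq: "\<forall>J\<in>multi p. \<forall>j. \<forall>m\<in>W. pd c j (F J) m = \<Phi> j J m"
    unfolding solves_form_system_def by blast
  then show "is_Phi_form A c p F W u (\<lambda>j J. pd c j (F J))"
    unfolding is_Phi_form_def form_eq_at_def by (simp cong: sum.cong)
qed (auto simp: solves_form_system_def)

text \<open>Both sides say that \<open>\<Theta>\<close>, the form whose components are the
  derivatives of \<open>F\<close> minus \<open>\<Phi>\<close>, vanishes: the system tests it on all
  tangent vectors, the coefficients in \<open>d\<close> test it on the coordinate vectors of
  \<open>d\<close>, which form a basis.\<close>

lemma solves_form_system_iff:
  assumes d: "coord_system A d" and W: "open W" "W \<subseteq> fst c \<inter> fst d"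
    and u: "\<And>j h. pd c j (\<lambda>y. u y $ h) = pd c j (\<lambda>y. snd d y $ h)"
  shows "solves_form_system A c p F W u \<longleftrightarrow>
    (\<forall>K\<in>multi p. \<forall>j. \<forall>m\<in>W. pd c j (form_coeff A d \<omega> K) m = 0)"
proof -
  define \<Theta> where "\<Theta> j m = variation p (\<lambda>I. F I m) (\<lambda>I. pd c j (F I) m) (\<lambda>i l. - Gam c u j l i m)" for j m
  let ?x = "\<lambda>X :: 'a tvec. \<lambda>i. X (\<lambda>y. snd c y $ i)"
  have lhs: "solves_form_system A c p F W u \<longleftrightarrow>
      (\<forall>m\<in>W. \<forall>j Xs. length Xs = p \<and> set Xs \<subseteq> tangent A m \<longrightarrow> \<Theta> j m (map ?x Xs) = 0)"
    unfolding solves_form_system_iff_Phi is_Phi_form_def form_eq_at_iff_diff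
  proof (intro ball_cong refl all_cong1 imp_cong)
    fix m j Xs assume "m \<in> W" and Xs: "length Xs = p \<and> set Xs \<subseteq> tangent A m"
    have w: "wedge_dx A c I m Xs = wedge (map (\<lambda>i v. v i) I) (map ?x Xs)" if "length I = p" for I
      by (rule wedge_dx_components[OF manifold]) (use Xs that in auto)
    have "(\<Sum>J\<in>multi p. pd c j (F J) m * wedge_dx A c J m Xs) -
        (\<Sum>I\<in>multi p. \<Sum>h<p. \<Sum>i\<in>UNIV. Gam c u j i (I ! h) m * F I m * wedge_dx A c (I[h := i]) m Xs) = \<Theta> j m (map ?x Xs)"
      by (simp add: \<Theta>_def variation_def w length_multi sum_negf)
    then show "((\<Sum>J\<in>multi p. pd c j (F J) m * wedge_dx A c J m Xs) -
        (\<Sum>I\<in>multi p. \<Sum>h<p. \<Sum>i\<in>UNIV. Gam c u j i (I ! h) m * F I m * wedge_dx A c (I[h := i]) m Xs) = 0) =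
        (\<Theta> j m (map ?x Xs) = 0)" by simp
  qed
  have pd: "pd c j (form_coeff A d \<omega> K) m = \<Theta> j m (map (\<lambda>k i. pd d k (\<lambda>y. snd c y $ i) m) K)"
    if m: "m \<in> W" and K: "length K = p" for m j K
  proof -
    have m': "m \<in> fst c" "m \<in> fst d" using m W by auto
    have "pd c j (form_coeff A d \<omega> K) m =
        pd c j (\<lambda>y. \<Sum>I\<in>multi p. F I y * wedge (map (\<lambda>i k. pd d k (\<lambda>y. snd c y $ i) y) I) K) m"
      by (rule pd_cong[OF manifold c m'(1) W(1) m]) (use W(2) form_coeff_eq[OF d _ _ K] in auto)
    also have "\<dots> = \<Theta> j m (map (\<lambda>k i. pd d k (\<lambda>y. snd c y $ i) m) K)"
      unfolding \<Theta>_def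
    proof (rule pd_coeff[OF manifold c d m' u K, where M="\<lambda>i k. pd d k (\<lambda>y. snd c y $ i)"])
      show "pd c j (pd d k (\<lambda>y. snd c y $ i)) m = (\<Sum>l\<in>UNIV. - Gam c u j l i m * pd d k (\<lambda>y. snd c y $ l) m)" for i k
        by (rule pd_inv_jac[OF manifold c d m' u])
      show "smooth_near A m (pd d k (\<lambda>y. snd c y $ i))" for i k
        by (rule smooth_near_inv_jac[OF manifold c d m' u])
    qed (rule smooth_near_form_component[OF m'(1)])
    finally show ?thesis .
  qed
  show ?thesis
  proof
    assume sys: "solves_form_system A c p F W u"
    show "\<forall>K\<in>multi p. \<forall>j. \<forall>m\<in>W. pd c j (form_coeff A d \<omega> K) m = 0"
    proof (intro ballI allI)
      fix K :: "'n list" and j m assume K: "K \<in> multi p" and m: "m \<in> W"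
      have m': "m \<in> fst c" "m \<in> fst d" using m W by auto
      let ?Xs = "map (\<lambda>k. coord_vec A d k m) K"
      have "map ?x ?Xs = map (\<lambda>k i. pd d k (\<lambda>y. snd c y $ i) m) K"
        by (simp add: coord_vec_apply[OF manifold d m'(2)] smooth_near_coord[OF manifold c m'(1)])
      moreover have "\<Theta> j m (map ?x ?Xs) = 0"
        by (rule sys[unfolded lhs, rule_format, OF m])
           (auto simp: length_multi[OF K] intro: coord_vec_tangent[OF manifold d m'(2)])
      ultimately show "pd c j (form_coeff A d \<omega> K) m = 0"
        using pd[OF m length_multi[OF K], of j] by (simp only:)
    qed
  next
    assume zero: "\<forall>K\<in>multi p. \<forall>j. \<forall>m\<in>W. pd c j (form_coeff A d \<omega> K) m = 0"
    show "solves_form_system A c p F W u"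
      unfolding lhs
    proof (intro ballI allI impI)
      fix m j Xs assume m: "m \<in> W" and Xs: "length Xs = p \<and> set Xs \<subseteq> tangent A m"
      have m': "m \<in> fst c" "m \<in> fst d" using m W by auto
      show "\<Theta> j m (map ?x Xs) = 0"
        unfolding \<Theta>_def
      proof (rule variation_eq_0[where M="\<lambda>i k. pd d k (\<lambda>y. snd c y $ i) m"])
        show "(\<Sum>k\<in>UNIV. pd d k (\<lambda>y. snd c y $ i) m * pd c j (\<lambda>y. snd d y $ k) m) = (if i = j then 1 else 0)" for i j
          by (rule coord_change_inverse[OF manifold c d m'])
        show "variation p (\<lambda>I. F I m) (\<lambda>I. pd c j (F I) m) (\<lambda>i l. - Gam c u j l i m)
            (map (\<lambda>k i. pd d k (\<lambda>y. snd c y $ i) m) K) = 0" if K: "K \<in> multi p" for K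
          using pd[OF m length_multi[OF K], of j] zero K m by (simp add: \<Theta>_def)
      qed (use Xs in simp)
    qed
  qed
qed

end

section \<open>The system for multivector fields\<close>

context
  fixes A :: "('a::{t2_space,second_countable_topology}, 'n::{finite,linorder}) chart set"
    and c :: "('a, 'n) chart" and q :: nat and V :: "'a \<Rightarrow> 'a covec list \<Rightarrow> real" and F :: "'n list \<Rightarrow> 'a \<Rightarrow> real"
  assumes manifold: "smooth_manifold A"
    and c: "coord_system A c"
    and mvec: "mvec_field A q V"
      "\<forall>m\<in>fst c. mvec_eq_at A q m (V m) (\<lambda>\<alpha>s. \<Sum>I\<in>multi q. F I m * wedge_vec A c I m \<alpha>s)"
begin

lemma coord_covec_coord_vec:
  assumes d: "coord_system A d" and m: "m \<in> fst c" "m \<in> fst d"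
  shows "coord_covec A d k m (coord_vec A c i m) = pd c i (\<lambda>y. snd d y $ k) m"
  using coord_vec_tangent[OF manifold c m(1), of i]
  by (simp add: coord_covec_def differential_def coord_vec_apply[OF manifold c m(1)] smooth_near_coord[OF manifold d m(2)])

lemma mvec_coeff_eq:
  assumes d: "coord_system A d" and m: "m \<in> fst c" "m \<in> fst d" and K: "length K = q"
  shows "mvec_coeff A d V K m =
    (\<Sum>I\<in>multi q. F I m * wedge (map (\<lambda>i k. pd c i (\<lambda>y. snd d y $ k) m) I) K)"
proof -
  let ?\<alpha>s = "map (\<lambda>i. coord_covec A d i m) K"
  have t: "set ?\<alpha>s \<subseteq> cotangent A m"
    using coord_covec_cotangent[OF manifold d m(2)] by auto
  have "mvec_coeff A d V K m = (\<Sum>I\<in>multi q. F I m * wedge_vec A c I m ?\<alpha>s)"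
    using mvec(2) m(1) t K unfolding mvec_eq_at_def mvec_coeff_def by simp
  also have "\<dots> = (\<Sum>I\<in>multi q. F I m * wedge (map (\<lambda>i k. pd c i (\<lambda>y. snd d y $ k) m) I) K)"
  proof (intro sum.cong refl arg_cong2[where f="(*)"])
    fix I :: "'n list" assume "I \<in> multi q"
    then have I: "length I = length K" using K by (simp add: length_multi)
    show "wedge_vec A c I m ?\<alpha>s = wedge (map (\<lambda>i k. pd c i (\<lambda>y. snd d y $ k) m) I) K"
      unfolding wedge_vec_def wedge_map_map[OF I] by (simp add: coord_covec_coord_vec[OF d m])
  qed
  finally show ?thesis .
qed

lemma smooth_near_mvec_component:
  assumes m: "m \<in> fst c" and J: "J \<in> multi q"
  shows "smooth_near A m (F J)"
proof (rule smooth_near_cong[OF manifold c m])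
  show "smooth_near A m (mvec_coeff A c V J)"
    using mvec(1) c J m coord_system_open[OF manifold c]
    unfolding mvec_field_def by (intro smooth_nearI[OF manifold, where W="fst c" and c=c]) blast+
  show "mvec_coeff A c V J y = F J y" if y: "y \<in> fst c" for y
  proof -
    have "mvec_coeff A c V J y = (\<Sum>I\<in>multi q. F I y * (if I = J then 1 else 0))"
      unfolding mvec_coeff_eq[OF c y y length_multi[OF J]]
      by (intro sum.cong refl arg_cong2[where f="(*)"])
         (simp add: pd_coord[OF manifold c y] wedge_multi_delta[symmetric] J eq_commute)
    then show ?thesis using J by (simp add: if_distrib[where f="\<lambda>x. _ * x"] cong: if_cong)
  qed
qed (use m coord_system_open[OF manifold c] in auto)

lemma solves_mvec_system_iff_Phi:
  "solves_mvec_system A c q F W u \<longleftrightarrow> is_Phi_mvec A c q F W u (\<lambda>j J m. - pd c j (F J) m)"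
proof
  assume "solves_mvec_system A c q F W u"
  then obtain \<Phi> where "is_Phi_mvec A c q F W u \<Phi>" and eq: "\<forall>J\<in>multi q. \<forall>j. \<forall>m\<in>W. pd c j (F J) m = - \<Phi> j J m"
    unfolding solves_mvec_system_def by blast
  then show "is_Phi_mvec A c q F W u (\<lambda>j J m. - pd c j (F J) m)"
    unfolding is_Phi_mvec_def mvec_eq_at_def by (simp cong: sum.cong)
qed (auto simp: solves_mvec_system_def)

text \<open>Dual to \<open>solves_form_system_iff\<close>: the coordinate covectors of
  \<open>d\<close> replace its coordinate vectors, their components form the Jacobian matrix itself,
  and \<open>\<Theta>\<close> is now derivative plus \<open>\<Phi>\<close>.\<close>

lemma solves_mvec_system_iff:
  assumes d: "coord_system A d" and W: "open W" "W \<subseteq> fst c \<inter> fst d"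
    and u: "\<And>j h. pd c j (\<lambda>y. u y $ h) = pd c j (\<lambda>y. snd d y $ h)"
  shows "solves_mvec_system A c q F W u \<longleftrightarrow>
    (\<forall>K\<in>multi q. \<forall>j. \<forall>m\<in>W. pd c j (mvec_coeff A d V K) m = 0)"
proof -
  define \<Theta> where "\<Theta> j m = variation q (\<lambda>I. F I m) (\<lambda>I. pd c j (F I) m) (\<lambda>i l. Gam c u j i l m)" for j m
  let ?x = "\<lambda>m (\<alpha> :: 'a covec) i. \<alpha> (coord_vec A c i m)"
  have lhs: "solves_mvec_system A c q F W u \<longleftrightarrow>
      (\<forall>m\<in>W. \<forall>j \<alpha>s. length \<alpha>s = q \<and> set \<alpha>s \<subseteq> cotangent A m \<longrightarrow> \<Theta> j m (map (?x m) \<alpha>s) = 0)"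
    unfolding solves_mvec_system_iff_Phi is_Phi_mvec_def mvec_eq_at_def
  proof (intro ball_cong refl all_cong1 imp_cong)
    fix m j \<alpha>s assume "m \<in> W" and \<alpha>s: "length \<alpha>s = q \<and> set \<alpha>s \<subseteq> cotangent A m"
    have w: "wedge_vec A c I m \<alpha>s = wedge (map (\<lambda>i v. v i) I) (map (?x m) \<alpha>s)" if "length I = q" for I
      by (rule wedge_vec_components) (use \<alpha>s that in auto)
    \<comment> \<open>Right side minus left side, because the left side carries the substituted
      value \<open>- pd c j (F J) m\<close>.\<close>
    have "(\<Sum>I\<in>multi q. \<Sum>h<q. \<Sum>i\<in>UNIV. Gam c u j (I ! h) i m * F I m * wedge_vec A c (I[h := i]) m \<alpha>s) -
        (\<Sum>J\<in>multi q. - pd c j (F J) m * wedge_vec A c J m \<alpha>s) = \<Theta> j m (map (?x m) \<alpha>s)"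
      by (simp add: \<Theta>_def variation_def w length_multi sum_negf)
    then show "((\<Sum>J\<in>multi q. - pd c j (F J) m * wedge_vec A c J m \<alpha>s) =
        (\<Sum>I\<in>multi q. \<Sum>h<q. \<Sum>i\<in>UNIV. Gam c u j (I ! h) i m * F I m * wedge_vec A c (I[h := i]) m \<alpha>s)) =
        (\<Theta> j m (map (?x m) \<alpha>s) = 0)" by argo
  qed
  have pd: "pd c j (mvec_coeff A d V K) m = \<Theta> j m (map (\<lambda>k i. pd c i (\<lambda>y. snd d y $ k) m) K)"
    if m: "m \<in> W" and K: "length K = q" for m j K
  proof -
    have m': "m \<in> fst c" "m \<in> fst d" using m W by auto
    have "pd c j (mvec_coeff A d V K) m =
        pd c j (\<lambda>y. \<Sum>I\<in>multi q. F I y * wedge (map (\<lambda>i k. pd c i (\<lambda>y. snd d y $ k) y) I) K) m"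
      by (rule pd_cong[OF manifold c m'(1) W(1) m]) (use W(2) mvec_coeff_eq[OF d _ _ K] in auto)
    also have "\<dots> = \<Theta> j m (map (\<lambda>k i. pd c i (\<lambda>y. snd d y $ k) m) K)"
      unfolding \<Theta>_def
    proof (rule pd_coeff[OF manifold c d m' u K, where M="\<lambda>i k. pd c i (\<lambda>y. snd d y $ k)"])
      show "pd c j (pd c i (\<lambda>y. snd d y $ k)) m = (\<Sum>l\<in>UNIV. Gam c u j i l m * pd c l (\<lambda>y. snd d y $ k) m)" for i k
        by (rule pd_jac[OF manifold c d m' u])
      show "smooth_near A m (pd c i (\<lambda>y. snd d y $ k))" for i k
        by (rule smooth_near_jac[OF manifold c d m' u])
    qed (rule smooth_near_mvec_component[OF m'(1)])
    finally show ?thesis .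
  qed
  show ?thesis
  proof
    assume sys: "solves_mvec_system A c q F W u"
    show "\<forall>K\<in>multi q. \<forall>j. \<forall>m\<in>W. pd c j (mvec_coeff A d V K) m = 0"
    proof (intro ballI allI)
      fix K :: "'n list" and j m assume K: "K \<in> multi q" and m: "m \<in> W"
      have m': "m \<in> fst c" "m \<in> fst d" using m W by auto
      let ?\<alpha>s = "map (\<lambda>k. coord_covec A d k m) K"
      have "map (?x m) ?\<alpha>s = map (\<lambda>k i. pd c i (\<lambda>y. snd d y $ k) m) K"
        by (simp add: coord_covec_coord_vec[OF d m'])
      moreover have "\<Theta> j m (map (?x m) ?\<alpha>s) = 0"
        by (rule sys[unfolded lhs, rule_format, OF m])
           (auto simp: length_multi[OF K] intro: coord_covec_cotangent[OF manifold d m'(2)])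
      ultimately show "pd c j (mvec_coeff A d V K) m = 0"
        using pd[OF m length_multi[OF K], of j] by (simp only:)
    qed
  next
    assume zero: "\<forall>K\<in>multi q. \<forall>j. \<forall>m\<in>W. pd c j (mvec_coeff A d V K) m = 0"
    show "solves_mvec_system A c q F W u"
      unfolding lhs
    proof (intro ballI allI impI)
      fix m j \<alpha>s assume m: "m \<in> W" and \<alpha>s: "length \<alpha>s = q \<and> set \<alpha>s \<subseteq> cotangent A m"
      have m': "m \<in> fst c" "m \<in> fst d" using m W by auto
      show "\<Theta> j m (map (?x m) \<alpha>s) = 0"
        unfolding \<Theta>_def
      proof (rule variation_eq_0[where M="\<lambda>i k. pd c i (\<lambda>y. snd d y $ k) m"])
        show "(\<Sum>k\<in>UNIV. pd c i (\<lambda>y. snd d y $ k) m * pd d k (\<lambda>y. snd c y $ j) m) = (if i = j then 1 else 0)" for i j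
          using coord_change_inverse[OF manifold c d m', of j i] by (auto simp: ac_simps)
        show "variation q (\<lambda>I. F I m) (\<lambda>I. pd c j (F I) m) (\<lambda>i l. Gam c u j i l m)
            (map (\<lambda>k i. pd c i (\<lambda>y. snd d y $ k) m) K) = 0" if K: "K \<in> multi q" for K
          using pd[OF m length_multi[OF K], of j] zero K m by (simp add: \<Theta>_def)
      qed (use \<alpha>s in simp)
    qed
  qed
qed

end

section \<open>Coordinate systems from nondegenerate functions\<close>

text \<open>Holds at every point: the two functions have the same derivatives \<open>D\<close>, so
  \<open>deriv\<close> picks the same value even where there is none. This makes
  \<open>pd_diff_const\<close> an equality of functions, the form required of
  \<open>u\<close>.\<close>

lemma partial_diff_const: "partial i (\<lambda>y. f y - k) y = partial i f y"
proof -
  have "((\<lambda>t. f (y + t *\<^sub>R axis i 1) - k) has_real_derivative D) (at 0) \<longleftrightarrow>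
      ((\<lambda>t. f (y + t *\<^sub>R axis i 1)) has_real_derivative D) (at 0)" for D
    using DERIV_add[OF _ DERIV_const, of "\<lambda>t. f (y + t *\<^sub>R axis i 1) - k" D 0 UNIV k]
      DERIV_diff[OF _ DERIV_const, of "\<lambda>t. f (y + t *\<^sub>R axis i 1)" D 0 UNIV k] by auto
  then show ?thesis
    unfolding partial_def deriv_def by simp
qed

lemma pd_diff_const: "pd c j (\<lambda>y. f y - k) = pd c j f"
  by (simp add: fun_eq_iff pd_def partial_diff_const)

lemma sorted_list_UNIV_multi: "sorted_list_of_set (UNIV :: 'n::{finite,linorder} set) \<in> multi CARD('n)"
  by (simp add: multi_def)

context
  fixes A :: "('a::{t2_space,second_countable_topology}, 'n::{finite,linorder}) chart set"
  assumes manifold: "smooth_manifold A"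
begin

text \<open>On the coordinate vectors of \<open>d\<close> the exterior product of the coordinate
  differentials takes the value 1.\<close>

lemma jet2_coords_in_O2:
  assumes d: "coord_system A d" and m: "m \<in> fst d"
  shows "jet2 A m (snd d) \<in> O2 A"
proof -
  let ?l = "sorted_list_of_set (UNIV :: 'n set)"
  let ?Xs = "map (\<lambda>i. coord_vec A d i m) ?l"
  have t: "set ?Xs \<subseteq> tangent A m"
    using coord_vec_tangent[OF manifold d m] by auto
  have len: "length ?l = CARD('n)" by simp
  have "wedge (map (\<lambda>h. differential A (\<lambda>y. snd d y $ h) m) ?l) ?Xs = wedge_dx A d ?l m ?Xs"
    by (simp add: wedge_dx_def coord_covec_def)
  also have "\<dots> = wedge (map (\<lambda>i v. v i) ?l) (map (\<lambda>k i. if i = k then 1 else 0) ?l)"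
    by (subst wedge_dx_components[OF manifold _ t])
       (simp_all add: o_def coord_vec_apply[OF manifold d m] smooth_near_coord[OF manifold d m] pd_coord[OF manifold d m])
  also have "\<dots> = wedge (map (\<lambda>i k. if i = k then 1 else 0) ?l) ?l"
    by (rule wedge_map_map) simp
  also have "\<dots> = 1"
    by (simp add: wedge_multi_delta[OF sorted_list_UNIV_multi sorted_list_UNIV_multi])
  finally have "\<not> form_eq_at A CARD('n) m (wedge (map (\<lambda>h. differential A (\<lambda>y. snd d y $ h) m) ?l)) (\<lambda>_. 0)"
    using t len unfolding form_eq_at_def by (metis length_map zero_neq_one)
  moreover have "m \<in> points A"
    using coord_system_points[OF manifold d] m by blast
  ultimately show ?thesis
    unfolding O2_def using smooth_near_coord[OF manifold d m] by blast
qed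

text \<open>On tangent vectors where the exterior product is nonzero, \<open>tangent_expand\<close>
  writes the matrix of its values as Jacobian matrix times component matrix, so the determinant
  factors.\<close>

lemma jet2_O2_det_jacobian:
  assumes c: "coord_system A c" and m: "m \<in> fst c"
    and u: "\<And>h. smooth_near A m (\<lambda>y. u y $ h)" and jet: "jet2 A m u \<in> O2 A"
  shows "det (jacobian c u m) \<noteq> 0"
proof -
  let ?l = "sorted_list_of_set (UNIV :: 'n set)"
  obtain w where w: "jet2 A m u = jet2 A m w" "\<And>h. smooth_near A m (\<lambda>y. w y $ h)"
    and nz: "\<not> form_eq_at A CARD('n) m (wedge (map (\<lambda>h. differential A (\<lambda>y. w y $ h) m) ?l)) (\<lambda>_. 0)"
    using jet unfolding O2_def jet2_def by auto
  have "u \<in> snd (jet2 A m u)"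
    using u by (auto simp: jet2_def)
  \<comment> \<open>\<open>O2\<close> provides only some representative \<open>w\<close> of the jet;
    as \<open>u\<close> lies in its own class, it lies in that of \<open>w\<close>, which has the
    same first derivatives in \<open>c\<close>.\<close>
  then have "u \<in> snd (jet2 A m w)" using w(1) by simp
  then have pd: "pd c i (\<lambda>y. w y $ h) m = pd c i (\<lambda>y. u y $ h) m" for h i
    using c m unfolding jet2_def snd_conv mem_Collect_eq by metis
  obtain Xs where Xs: "length Xs = CARD('n)" "set Xs \<subseteq> tangent A m"
    and nz': "wedge (map (\<lambda>h. differential A (\<lambda>y. w y $ h) m) ?l) Xs \<noteq> 0"
    using nz unfolding form_eq_at_def by blast
  obtain e :: "nat \<Rightarrow> 'n" where e: "bij_betw e {..<CARD('n)} UNIV"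
    and det: "\<And>\<alpha> :: 'n \<Rightarrow> 'a tvec \<Rightarrow> real. wedge (map \<alpha> ?l) Xs =
      det (\<chi> i j. \<alpha> i (Xs ! inv_into {..<CARD('n)} e j))"
    by (rule wedge_det[OF Xs(1)]) blast
  define X where "X j = Xs ! inv_into {..<CARD('n)} e j" for j
  have X: "X j \<in> tangent A m" for j
  proof -
    have "inv_into {..<CARD('n)} e j \<in> {..<CARD('n)}"
      by (rule inv_into_into) (use e in \<open>auto simp: bij_betw_def\<close>)
    then show ?thesis using Xs by (auto simp: X_def subset_iff)
  qed
  have "(\<chi> i j. differential A (\<lambda>y. w y $ i) m (X j)) = jacobian c u m ** (\<chi> i j. X j (\<lambda>y. snd c y $ i))"
    by (simp add: vec_eq_iff matrix_matrix_mult_def jacobian_def differential_def X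
        tangent_expand[OF manifold c m X w(2)] pd)
  then have "wedge (map (\<lambda>h. differential A (\<lambda>y. w y $ h) m) ?l) Xs =
      det (jacobian c u m) * det (\<chi> i j. X j (\<lambda>y. snd c y $ i))"
    unfolding det X_def[symmetric] by (simp add: det_mul)
  then show ?thesis using nz' by auto
qed

lemma smooth_fun_on_imp_smooth_near:
  "smooth_fun_on A W f \<Longrightarrow> open W \<Longrightarrow> W \<subseteq> fst c \<Longrightarrow> coord_system A c \<Longrightarrow> m \<in> W \<Longrightarrow> smooth_near A m f"
  using smooth_nearI[OF manifold] by blast

text \<open>The inverse function theorem, applied to \<open>u - u x\<close> expressed in the chart
  \<open>c\<close>. The radius is exported because constancy is derived on a convex image.\<close>

lemma coord_system_of_functions:
  assumes c: "coord_system A c" and W: "open W" "W \<subseteq> fst c" "x \<in> W"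
    and u: "\<And>h. smooth_fun_on A W (\<lambda>y. u y $ h)"
    and det: "det (jacobian c u x) \<noteq> 0"
  obtains d r where "coord_system A d" "x \<in> fst d" "fst d \<subseteq> W" "snd d = (\<lambda>m. u m - u x)"
    "0 < r" "snd d ` fst d = ball 0 r"
proof -
  have ch: "is_chart c" by (rule coord_system_chart[OF manifold c])
  define f where "f y = u (chart_inv c y) - u x" for y
  define S where "S = snd c ` W"
  have S: "open S" unfolding S_def by (rule open_chart_image_sub[OF ch W(1,2)])
  have x: "x \<in> fst c" and a: "snd c x \<in> S" using W by (auto simp: S_def)
  have f: "smooth_on S (\<lambda>z. f z $ i)" for i
    using smooth_on_add[OF S smooth_fun_onD[OF manifold u c W(2), folded S_def] smooth_on_const[OF S, of "- (u x $ i)"]]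
    by (simp add: f_def)
  have "(\<chi> i j. partial j (\<lambda>z. f z $ i) (snd c x)) = jacobian c u x"
    by (simp add: f_def jacobian_def pd_def partial_diff_const)
  then have "det (\<chi> i j. partial j (\<lambda>z. f z $ i) (snd c x)) \<noteq> 0"
    using det by simp
  then obtain U V g where U: "open U" "U \<subseteq> S" "snd c x \<in> U" and V: "open V" and hom: "homeomorphism U V f g"
    and g: "\<And>j. smooth_on V (\<lambda>y. g y $ j)"
    using smooth_inverse_function[OF S f a] by metis
  have fx: "f (snd c x) = 0"
    by (simp add: f_def chart_inv_apply[OF ch x])
  then have "0 \<in> V"
    using hom U(3) unfolding homeomorphism_def by force
  then obtain r where r: "0 < r" "ball 0 r \<subseteq> V"
    using V open_contains_ball by blast
  have fg: "f (g y) = y" "g y \<in> U" if "y \<in> V" for y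
    using hom that unfolding homeomorphism_def by auto
  have gf: "g (f z) = z" if "z \<in> U" for z
    using hom that unfolding homeomorphism_def by auto
  \<comment> \<open>On this domain the translated map is injective with image exactly the ball, and
    its inverse is \<open>chart_inv c\<close> after \<open>g\<close>.\<close>
  define d :: "('a, 'n) chart" where "d = (fst c \<inter> snd c -` (U \<inter> f -` ball 0 r), \<lambda>m. u m - u x)"
  have sd: "snd d = (\<lambda>m. u m - u x)" by (simp add: d_def)
  have dc: "m \<in> fst d \<longleftrightarrow> m \<in> fst c \<and> snd c m \<in> U \<and> f (snd c m) \<in> ball 0 r" for m
    by (auto simp: d_def)
  have sdm: "snd d m = f (snd c m)" if "m \<in> fst c" for m
    using that by (simp add: sd f_def chart_inv_apply[OF ch])
  have dW: "fst d \<subseteq> W"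
  proof
    fix m assume "m \<in> fst d"
    then have m: "m \<in> fst c" "snd c m \<in> S" using dc U(2) by auto
    then obtain m' where "m' \<in> W" "snd c m = snd c m'" by (auto simp: S_def)
    then show "m \<in> W"
      using chart_inv_apply[OF ch] m(1) W(2) by (metis subsetD)
  qed
  have xd: "x \<in> fst d"
    using x U(3) fx r(1) by (simp add: dc)
  have cg: "chart_inv c (g y) \<in> fst c" "snd c (chart_inv c (g y)) = g y" if "y \<in> V" for y
  proof -
    have "g y \<in> snd c ` fst c"
      using fg(2)[OF that] U(2) W(2) by (auto simp: S_def)
    then show "chart_inv c (g y) \<in> fst c" "snd c (chart_inv c (g y)) = g y"
      by (rule chart_inv_in apply_chart_inv)+
  qed
  have cgd: "chart_inv c (g y) \<in> fst d" "snd d (chart_inv c (g y)) = y" if "y \<in> ball 0 r" for y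
  proof -
    have y: "y \<in> V" using r(2) that by blast
    show "snd d (chart_inv c (g y)) = y"
      by (simp add: sdm[OF cg(1)[OF y]] cg(2)[OF y] fg(1)[OF y])
    show "chart_inv c (g y) \<in> fst d"
      using cg[OF y] fg[OF y] that by (simp add: dc)
  qed
  have image: "snd d ` fst d = ball 0 r"
  proof
    show "snd d ` fst d \<subseteq> ball 0 r"
      using sdm dc by auto
    show "ball 0 r \<subseteq> snd d ` fst d"
    proof
      fix y :: "(real, 'n) vec" assume "y \<in> ball 0 r"
      from cgd[OF this] show "y \<in> snd d ` fst d" by (metis imageI)
    qed
  qed
  have inj: "inj_on (snd d) (fst d)"
  proof (rule inj_onI)
    fix m m' assume *: "m \<in> fst d" "m' \<in> fst d" "snd d m = snd d m'"
    then have "f (snd c m) = f (snd c m')" using sdm dc by simp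
    then have "snd c m = snd c m'" using gf * dc by metis
    then show "m = m'" using chart_inv_apply[OF ch] * dc by metis
  qed
  have di: "chart_inv d y = chart_inv c (g y)" if "y \<in> ball 0 r" for y
    by (rule inv_into_f_eq[OF inj cgd[OF that]])
  have "continuous_on U f" "continuous_on V g"
    using hom by (auto simp: homeomorphism_def)
  have "open (U \<inter> f -` ball 0 r)"
    by (rule continuous_open_preimage[OF \<open>continuous_on U f\<close> U(1)]) simp
  from open_chart_preimage[OF ch this] have od: "open (fst d)"
    by (simp add: d_def)
  have chd: "is_chart d"
    unfolding is_chart_def image
  proof (intro conjI od homeomorphismI)
    have cc: "continuous_on (fst c) (snd c)" "continuous_on (snd c ` fst c) (chart_inv c)"
      using ch by (auto simp: is_chart_def homeomorphism_def)
    have "continuous_on (fst d) (\<lambda>m. f (snd c m))"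
      by (rule continuous_on_compose2[OF \<open>continuous_on U f\<close> continuous_on_subset[OF cc(1)]]) (auto simp: dc)
    then show "continuous_on (fst d) (snd d)"
      by (rule continuous_on_eq) (simp add: dc sdm)
    have "continuous_on (ball 0 r) (\<lambda>y. chart_inv c (g y))"
    proof (rule continuous_on_compose2[OF cc(2) continuous_on_subset[OF \<open>continuous_on V g\<close> r(2)]])
      show "g ` ball 0 r \<subseteq> snd c ` fst c"
        using fg(2) r(2) U(2) W(2) by (fastforce simp: S_def)
    qed
    then show "continuous_on (ball 0 r) (chart_inv d)"
      by (rule continuous_on_eq) (simp add: di)
    show "chart_inv d ` ball 0 r \<subseteq> fst d"
      using cgd(1) di by auto
    show "chart_inv d (snd d m) = m" if "m \<in> fst d" for m
      by (rule inv_into_f_f[OF inj that])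
    show "snd d (chart_inv d y) = y" if "y \<in> ball 0 r" for y
      using cgd(2) di that by simp
  qed (use image in auto)
  have cd: "coord_system A d"
    unfolding coord_system_def
  proof (intro conjI ballI chd)
    show "fst d \<subseteq> points A"
      using dW W(2) coord_system_points[OF manifold c] by blast
    fix e assume e: "e \<in> A"
    then have ce: "coord_system A e" by (rule atlas_coord_system[OF manifold])
    then have che: "is_chart e" by (rule coord_system_chart[OF manifold])
    have oe: "open (fst e)" using che by (simp add: is_chart_def)
    \<comment> \<open>From \<open>d\<close> to \<open>e\<close> smoothness comes from the smooth
      inverse \<open>g\<close>; in the opposite direction it is the smoothness of \<open>u\<close>
      itself.\<close>
    show "smooth_transition d e"
      unfolding smooth_transition_def
    proof
      fix i
      let ?T = "snd d ` (fst d \<inter> fst e)" and ?T' = "snd c ` (fst c \<inter> fst e)"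
      have T: "open ?T" by (rule open_chart_image[OF chd oe])
      have T': "open ?T'" by (rule open_chart_image[OF ch oe])
      have b: "y \<in> ball 0 r" if "y \<in> ?T" for y using that image by blast
      have "smooth_on ?T (\<lambda>y. snd e (chart_inv c (g y)) $ i)"
      proof (rule smooth_on_compose[OF T T', of g "\<lambda>z. snd e (chart_inv c z) $ i"])
        show "g ` ?T \<subseteq> ?T'"
        proof
          fix z assume "z \<in> g ` ?T"
          then obtain m where m: "m \<in> fst d" "m \<in> fst e" "z = g (snd d m)" by blast
          then have "z = snd c m" using gf sdm dc by metis
          then show "z \<in> ?T'" using m dc by blast
        qed
        show "smooth_on ?T' (\<lambda>z. snd e (chart_inv c z) $ i)"
          using coord_system_transition[OF manifold c ce] by (simp add: smooth_transition_def)
        show "smooth_on ?T (\<lambda>y. g y $ j)" for j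
          by (rule smooth_on_subset[OF g]) (use b r(2) in blast)
      qed
      then show "smooth_on ?T (\<lambda>y. snd e (chart_inv d y) $ i)"
        by (rule smooth_on_cong[OF T, rotated]) (simp only: di[OF b])
    qed
    show "smooth_transition e d"
      unfolding smooth_transition_def
    proof
      fix i
      let ?T = "snd e ` (fst e \<inter> fst d)"
      have T: "open ?T" by (rule open_chart_image[OF che od])
      have "smooth_on (snd e ` (fst e \<inter> W)) (\<lambda>y. u (chart_inv e y) $ i)"
        using u[of i] ce by (simp add: smooth_fun_on_def)
      then have "smooth_on ?T (\<lambda>y. u (chart_inv e y) $ i)"
        by (rule smooth_on_subset) (use dW in auto)
      from smooth_on_add[OF T this smooth_on_const[OF T, of "- (u x $ i)"]]
      show "smooth_on ?T (\<lambda>y. snd d (chart_inv e y) $ i)"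
        by (simp add: sd)
    qed
  qed
  show ?thesis
    by (rule that[OF cd xd dW sd r(1) image])
qed

text \<open>The system controls derivatives in \<open>c\<close>, but the convex image belongs to
  \<open>d\<close>; the chain rule carries the vanishing over, and a zero derivative on a ball gives
  a constant.\<close>

lemma constant_on_ball_chart:
  assumes c: "coord_system A c" and d: "coord_system A d" and sub: "fst d \<subseteq> fst c"
    and r: "snd d ` fst d = ball 0 r"
    and f: "smooth_fun_on A (fst d) f" and zero: "\<And>j m. m \<in> fst d \<Longrightarrow> pd c j f m = 0"
  shows "f constant_on fst d"
proof -
  have chd: "is_chart d" by (rule coord_system_chart[OF manifold d])
  let ?f = "\<lambda>y. f (chart_inv d y)"
  have "(?f has_derivative (\<lambda>_. 0)) (at y)" if "y \<in> ball 0 r" for y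
  proof -
    obtain m where m: "m \<in> fst d" "y = snd d m" using \<open>y \<in> ball 0 r\<close> r by blast
    then have mc: "m \<in> fst c" using sub by blast
    have near: "smooth_near A m f"
      by (rule smooth_nearI[OF manifold f coord_system_open[OF manifold d] m(1) order_refl d])
    have "partial j ?f y = 0" for j
    proof -
      have "partial j ?f y = pd d j f m" by (simp add: pd_def m)
      also have "\<dots> = (\<Sum>k\<in>UNIV. pd c k f m * pd d j (\<lambda>y. snd c y $ k) m)"
        by (rule pd_chain[OF manifold d m(1) c mc near])
      finally show ?thesis by (simp add: zero m(1))
    qed
    then show ?thesis
      using has_derivative_partial[OF smooth_near_differentiable[OF manifold d m(1) near]] by (simp add: m(2))
  qed
  then obtain k where k: "\<And>y. y \<in> ball 0 r \<Longrightarrow> ?f y = k"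
    using has_derivative_zero_constant[of "ball 0 r" ?f] by (metis convex_ball has_derivative_at_withinI)
  have "f m = k" if "m \<in> fst d" for m
    using k[of "snd d m"] chart_inv_apply[OF chd that] that r by (metis imageI)
  then show ?thesis unfolding constant_on_def by blast
qed

text \<open>Forms and multivector fields are treated together: \<open>coeff d\<close> are the coefficients with
  respect to the chart \<open>d\<close>, and \<open>solves W u\<close> says that \<open>u\<close> solves the system on \<open>W\<close>.\<close>

lemma constant_coeffs_iff_solution:
  fixes coeff :: "('a, 'n) chart \<Rightarrow> 'i \<Rightarrow> 'a \<Rightarrow> real" and solves :: "'a set \<Rightarrow> ('a, 'n) fun_system \<Rightarrow> bool"
  assumes c: "coord_system A c" "x \<in> fst c"
    and smooth: "\<And>d I. coord_system A d \<Longrightarrow> I \<in> \<I> \<Longrightarrow> smooth_fun_on A (fst d) (coeff d I)"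
    and mono: "\<And>W W' u. solves W u \<Longrightarrow> W' \<subseteq> W \<Longrightarrow> solves W' u"
    and solves: "\<And>d W u. coord_system A d \<Longrightarrow> open W \<Longrightarrow> W \<subseteq> fst c \<inter> fst d \<Longrightarrow>
      (\<And>j h. pd c j (\<lambda>y. u y $ h) = pd c j (\<lambda>y. snd d y $ h)) \<Longrightarrow>
      solves W u \<longleftrightarrow> (\<forall>I\<in>\<I>. \<forall>j. \<forall>m\<in>W. pd c j (coeff d I) m = 0)"
  shows "(\<exists>d. coord_system A d \<and> x \<in> fst d \<and> snd d x = 0 \<and> (\<forall>I\<in>\<I>. coeff d I constant_on fst d)) \<longleftrightarrow>
    (\<exists>W u. open W \<and> x \<in> W \<and> W \<subseteq> fst c \<and> (\<forall>h. smooth_fun_on A W (\<lambda>y. u y $ h)) \<and>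
      (\<forall>m\<in>W. jet2 A m u \<in> O2 A) \<and> solves W u)" (is "?const \<longleftrightarrow> ?sol")
proof
  assume ?const
  then obtain d where d: "coord_system A d" "x \<in> fst d" and const: "\<And>I. I \<in> \<I> \<Longrightarrow> coeff d I constant_on fst d"
    by blast
  \<comment> \<open>The coordinates of \<open>d\<close> themselves are the solution, on the overlap
    of the two domains.\<close>
  let ?W = "fst c \<inter> fst d"
  have W: "open ?W" using coord_system_open[OF manifold] c d by blast
  have "pd c j (coeff d I) m = 0" if I: "I \<in> \<I>" and m: "m \<in> ?W" for I j m
  proof -
    obtain k where k: "\<And>y. y \<in> fst d \<Longrightarrow> coeff d I y = k"
      using const[OF I] unfolding constant_on_def by blast
    have mc: "m \<in> fst c" using m by blast
    have "pd c j (coeff d I) m = pd c j (\<lambda>_. k) m"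
      by (rule pd_cong[OF manifold c(1) mc W m]) (use k in auto)
    then show ?thesis by (simp add: pd_const[OF manifold c(1) mc])
  qed
  then have "solves ?W (snd d)"
    using solves[OF d(1) W order_refl refl] by blast
  moreover have "smooth_fun_on A ?W (\<lambda>y. snd d y $ h)" for h
    by (rule smooth_fun_on_subset[OF manifold smooth_fun_on_coord[OF manifold d(1)]]) simp
  moreover have "\<forall>m\<in>?W. jet2 A m (snd d) \<in> O2 A"
    using jet2_coords_in_O2[OF d(1)] by blast
  ultimately show ?sol
    using W c d by (intro exI[of _ ?W] exI[of _ "snd d"]) auto
next
  assume ?sol
  then obtain W u where W: "open W" "x \<in> W" "W \<subseteq> fst c" and u: "\<And>h. smooth_fun_on A W (\<lambda>y. u y $ h)"
    and jet: "jet2 A x u \<in> O2 A" and sol: "solves W u"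
    by blast
  have "det (jacobian c u x) \<noteq> 0"
    by (rule jet2_O2_det_jacobian[OF c smooth_fun_on_imp_smooth_near[OF u W(1,3) c(1) W(2)] jet])
  then obtain d r where d: "coord_system A d" "x \<in> fst d" "fst d \<subseteq> W" "snd d = (\<lambda>m. u m - u x)"
      "snd d ` fst d = ball 0 r"
    using coord_system_of_functions[OF c(1) W(1,3,2) u] by metis
  \<comment> \<open>Translation by \<open>u x\<close> changes no derivative, so the system for
    \<open>u\<close> characterises the coefficients in the centred chart \<open>d\<close>.\<close>
  have pd: "pd c j (\<lambda>y. u y $ h) = pd c j (\<lambda>y. snd d y $ h)" for j h
    by (simp add: d(4) pd_diff_const)
  have dc: "fst d \<subseteq> fst c \<inter> fst d" using d(3) W(3) by blast
  have "solves (fst d) u" by (rule mono[OF sol d(3)])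
  then have zero: "pd c j (coeff d I) m = 0" if "I \<in> \<I>" "m \<in> fst d" for I j m
    using solves[OF d(1) coord_system_open[OF manifold d(1)] dc pd] that by blast
  have "coeff d I constant_on fst d" if "I \<in> \<I>" for I
    by (rule constant_on_ball_chart[OF c(1) d(1) _ d(5) smooth[OF d(1) that] zero[OF that]])
       (use dc in auto)
  moreover have "snd d x = 0" by (simp add: d(4))
  ultimately show ?const using d(1,2) by blast
qed

end

lemma solves_form_system_mono:
  assumes "solves_form_system A c p F W u" "W' \<subseteq> W"
  shows "solves_form_system A c p F W' u"
proof -
  obtain \<Phi> where "is_Phi_form A c p F W u \<Phi>" "\<forall>J\<in>multi p. \<forall>j. \<forall>m\<in>W. pd c j (F J) m = \<Phi> j J m"
    using assms(1) unfolding solves_form_system_def by blast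
  then have "is_Phi_form A c p F W' u \<Phi>" "\<forall>J\<in>multi p. \<forall>j. \<forall>m\<in>W'. pd c j (F J) m = \<Phi> j J m"
    using assms(2) unfolding is_Phi_form_def by (simp_all add: subset_iff)
  then show ?thesis unfolding solves_form_system_def by blast
qed

lemma solves_mvec_system_mono:
  assumes "solves_mvec_system A c q F W u" "W' \<subseteq> W"
  shows "solves_mvec_system A c q F W' u"
proof -
  obtain \<Phi> where "is_Phi_mvec A c q F W u \<Phi>" "\<forall>J\<in>multi q. \<forall>j. \<forall>m\<in>W. pd c j (F J) m = - \<Phi> j J m"
    using assms(1) unfolding solves_mvec_system_def by blast
  then have "is_Phi_mvec A c q F W' u \<Phi>" "\<forall>J\<in>multi q. \<forall>j. \<forall>m\<in>W'. pd c j (F J) m = - \<Phi> j J m"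
    using assms(2) unfolding is_Phi_mvec_def by (simp_all add: subset_iff)
  then show ?thesis unfolding solves_mvec_system_def by blast
qed

theorem theorem3p1:
  fixes A :: "('a::{t2_space,second_countable_topology}, 'n::{finite,linorder}) chart set"
    and c :: "('a, 'n) chart"
    and x :: 'a
    and p q :: nat
    and \<omega> :: "'a \<Rightarrow> 'a tvec list \<Rightarrow> real"
    and V :: "'a \<Rightarrow> 'a covec list \<Rightarrow> real"
    and F G :: "'n list \<Rightarrow> 'a \<Rightarrow> real"
  assumes manifold: "smooth_manifold A"
    and p: "1 \<le> p" "p \<le> CARD('n)"
    and q: "1 \<le> q" "q \<le> CARD('n)"
    and coords: "coord_system A c" "x \<in> fst c"
    and form: "diff_form A p \<omega>"
      "\<forall>m\<in>fst c. form_eq_at A p m (\<omega> m) (\<lambda>Xs. \<Sum>I\<in>multi p. F I m * wedge_dx A c I m Xs)"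
    and mvec: "mvec_field A q V"
      "\<forall>m\<in>fst c. mvec_eq_at A q m (V m) (\<lambda>\<alpha>s. \<Sum>I\<in>multi q. G I m * wedge_vec A c I m \<alpha>s)"
  shows "(const_coeffs_form A p x \<omega> \<longleftrightarrow>
           (\<exists>W u. open W \<and> x \<in> W \<and> W \<subseteq> fst c \<and>
              (\<forall>h. smooth_fun_on A W (\<lambda>y. u y $ h)) \<and>
              (\<forall>m\<in>W. jet2 A m u \<in> O2 A) \<and>
              solves_form_system A c p F W u)) \<and>
         (const_coeffs_mvec A q x V \<longleftrightarrow>
           (\<exists>W u. open W \<and> x \<in> W \<and> W \<subseteq> fst c \<and>
              (\<forall>h. smooth_fun_on A W (\<lambda>y. u y $ h)) \<and>
              (\<forall>m\<in>W. jet2 A m u \<in> O2 A) \<and>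
              solves_mvec_system A c q G W u))"
proof
  show "const_coeffs_form A p x \<omega> \<longleftrightarrow>
           (\<exists>W u. open W \<and> x \<in> W \<and> W \<subseteq> fst c \<and>
              (\<forall>h. smooth_fun_on A W (\<lambda>y. u y $ h)) \<and>
              (\<forall>m\<in>W. jet2 A m u \<in> O2 A) \<and>
              solves_form_system A c p F W u)"
    unfolding const_coeffs_form_def
  proof (rule constant_coeffs_iff_solution[OF manifold coords])
    show "smooth_fun_on A (fst d) (form_coeff A d \<omega> I)" if "coord_system A d" "I \<in> multi p" for d I
      using form(1) that unfolding diff_form_def by blast
    show "solves_form_system A c p F W' u" if "solves_form_system A c p F W u" "W' \<subseteq> W" for W W' u
      using that solves_form_system_mono by blast
  qed (rule solves_form_system_iff[OF manifold coords(1) form])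
  show "const_coeffs_mvec A q x V \<longleftrightarrow>
           (\<exists>W u. open W \<and> x \<in> W \<and> W \<subseteq> fst c \<and>
              (\<forall>h. smooth_fun_on A W (\<lambda>y. u y $ h)) \<and>
              (\<forall>m\<in>W. jet2 A m u \<in> O2 A) \<and>
              solves_mvec_system A c q G W u)"
    unfolding const_coeffs_mvec_def
  proof (rule constant_coeffs_iff_solution[OF manifold coords])
    show "smooth_fun_on A (fst d) (mvec_coeff A d V I)" if "coord_system A d" "I \<in> multi q" for d I
      using mvec(1) that unfolding mvec_field_def by blast
    show "solves_mvec_system A c q G W' u" if "solves_mvec_system A c q G W u" "W' \<subseteq> W" for W W' u
      using that solves_mvec_system_mono by blast
  qed (rule solves_mvec_system_iff[OF manifold coords(1) mvec])
qed

end
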